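(* Let $p$ be a prime and let $a_1,a_2,a_3,b\in\mathbb{Z}_p$ with $a_1a_2a_3\neq 0$ and $a_i\neq a_j$ for some $i,j\in\{1,2,3\}$. A $3$-coloring $\mathbb{Z}_p=A\cup B\cup C$ with $1\leq |A|\leq |B|\leq |C|$ is rainbow-free for the equation $a_1x+a_2y+a_3z=b$ if and only if $A=\{s\}$ for some $s\in\mathbb{Z}_p$ with $s(a_1+a_2+a_3)=b$, and $T_i(B)=B$ and $T_i(C)=C$ for every $i\in\{1,2,\dots,6\}$.
   Context: A $3$-coloring of $\mathbb{Z}_p$ is a partition $\mathbb{Z}_p=A\cup B\cup C$ into three nonempty color classes. A set $\{s_1,s_2,s_3\}\subseteq\mathbb{Z}_p$ is a solution of $a_1x+a_2y+a_3z=b$ if $a_1s_i+a_2s_j+a_3s_k=b$ for some choice of $\{i,j,k\}=\{1,2,3\}$. A solution is rainbow if its elements belong pairwise to distinct color classes; a $3$-coloring is rainbow-free for an equation if it contains no rainbow solution of it. Given $s\in\mathbb{Z}_p$, the transformations $T_i:\mathbb{Z}_p\to\mathbb{Z}_p$ are $T_i(x)=d_ix+t_i$ (and $T_i(S)=\{d_ix+t_i:x\in S\}$ for $S\subseteq \mathbb{Z}_p$), where $d_1=-a_3a_1^{-1}$, $t_1=(b-a_2s)a_1^{-1}$; $d_2=-a_2a_1^{-1}$, $t_2=(b-a_3s)a_1^{-1}$; $d_3=-a_1a_2^{-1}$, $t_3=(b-a_3s)a_2^{-1}$; $d_4=-a_3a_2^{-1}$, $t_4=(b-a_1s)a_2^{-1}$;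 $d_5=-a_1a_3^{-1}$, $t_5=(b-a_2s)a_3^{-1}$; $d_6=-a_2a_3^{-1}$, $t_6=(b-a_1s)a_3^{-1}$. *)

theory Defs
  imports "Berlekamp_Zassenhaus.Finite_Field"
begin

text \<open>
  The field of integers modulo a prime is the library type \<open>'p mod_ring\<close> with
  \<open>'p :: prime_card\<close>; the prime is \<open>CARD('p)\<close>.
\<close>

definition three_coloring :: "'a set \<Rightarrow> 'a set \<Rightarrow> 'a set \<Rightarrow> bool" where
  "three_coloring A B C \<longleftrightarrow>
     A \<union> B \<union> C = UNIV \<and>
     A \<inter> B = {} \<and> A \<inter> C = {} \<and> B \<inter> C = {} \<and>
     A \<noteq> {} \<and> B \<noteq> {} \<and> C \<noteq> {}"

text \<open>
  Solutions are sets: the three elements may be substituted for the variables in any order.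
  The coefficients are \<open>a 1\<close>, \<open>a 2\<close>, \<open>a 3\<close>; other values of \<open>a\<close> play no role.
\<close>

definition is_solution ::
  "(nat \<Rightarrow> 'p::prime_card mod_ring) \<Rightarrow> 'p mod_ring \<Rightarrow> 'p mod_ring set \<Rightarrow> bool" where
  "is_solution a b S \<longleftrightarrow>
     (\<exists>s :: nat \<Rightarrow> 'p mod_ring. S = {s 1, s 2, s 3} \<and>
       (\<exists>i j k. {i, j, k} = {1, 2, 3} \<and> a 1 * s i + a 2 * s j + a 3 * s k = b))"

definition rainbow :: "'a set \<Rightarrow> 'a set \<Rightarrow> 'a set \<Rightarrow> 'a set \<Rightarrow> bool" where
  "rainbow A B C S \<longleftrightarrow> (\<exists>x\<in>A. \<exists>y\<in>B. \<exists>z\<in>C. S = {x, y, z})"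

definition rainbow_free ::
  "(nat \<Rightarrow> 'p::prime_card mod_ring) \<Rightarrow> 'p mod_ring \<Rightarrow>
   'p mod_ring set \<Rightarrow> 'p mod_ring set \<Rightarrow> 'p mod_ring set \<Rightarrow> bool" where
  "rainbow_free a b A B C \<longleftrightarrow> \<not> (\<exists>S. is_solution a b S \<and> rainbow A B C S)"

text \<open>
  The six affine maps \<open>x \<mapsto> d i * x + t i\<close> come from solving the equation for one variable
  with \<open>s\<close> substituted for another. Only the indices 1 to 6 are used; the last branch of
  each conditional is the case 6.
\<close>

definition trans_d :: "(nat \<Rightarrow> 'p::prime_card mod_ring) \<Rightarrow> nat \<Rightarrow> 'p mod_ring" where
  "trans_d a i =
     (if i = 1 then - a 3 * inverse (a 1)
      else if i = 2 then - a 2 * inverse (a 1)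
      else if i = 3 then - a 1 * inverse (a 2)
      else if i = 4 then - a 3 * inverse (a 2)
      else if i = 5 then - a 1 * inverse (a 3)
      else - a 2 * inverse (a 3))"

definition trans_t ::
  "(nat \<Rightarrow> 'p::prime_card mod_ring) \<Rightarrow> 'p mod_ring \<Rightarrow> 'p mod_ring \<Rightarrow> nat \<Rightarrow> 'p mod_ring" where
  "trans_t a b s i =
     (if i = 1 then (b - a 2 * s) * inverse (a 1)
      else if i = 2 then (b - a 3 * s) * inverse (a 1)
      else if i = 3 then (b - a 3 * s) * inverse (a 2)
      else if i = 4 then (b - a 1 * s) * inverse (a 2)
      else if i = 5 then (b - a 2 * s) * inverse (a 3)
      else (b - a 1 * s) * inverse (a 3))"

definition trans_T ::
  "(nat \<Rightarrow> 'p::prime_card mod_ring) \<Rightarrow> 'p mod_ring \<Rightarrow> 'p mod_ring \<Rightarrow> nat \<Rightarrow>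
   'p mod_ring \<Rightarrow> 'p mod_ring" where
  "trans_T a b s i x = trans_d a i * x + trans_t a b s i"

end

theory Submission
  imports Defs
begin

text \<open>
  Let \<open>f\<close> and \<open>h\<close> be the indicator functions of \<open>A\<close> and \<open>B\<close>. The coloring is rainbow-free iff the
  determinant with rows \<open>1\<close>, \<open>f\<close>, \<open>h\<close> at \<open>x\<close>, \<open>y\<close>, \<open>z\<close> vanishes on the plane
  \<open>a\<^sub>1 x + a\<^sub>2 y + a\<^sub>3 z = b\<close>. Weighting it by \<open>x\<^sup>s y\<^sup>t\<close> and summing over the plane gives, for all \<open>s\<close>
  and \<open>t\<close>, a linear relation between the minors \<open>W i j\<close> of the power moments of \<open>f\<close> and \<open>h\<close>.

  Degree 1 gives \<open>W 0 1 = 0\<close> unless all coefficients are equal, so a translation makes the first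
  moments of \<open>f\<close> and \<open>h\<close> vanish. Let \<open>K\<close> be the least index with \<open>W 0 K \<noteq> 0\<close>. Degree \<open>K\<close> gives
  \<open>(- a\<^sub>i / a\<^sub>j)\<^sup>K = 1\<close>, and degree \<open>K + 1\<close> gives \<open>b = 0\<close>. By induction on \<open>\<delta>\<close>, degree \<open>K + \<delta>\<close>
  gives \<open>W \<delta> K = 0\<close> for \<open>0 < \<delta> < p - 1\<close>. Hence a combination of \<open>f\<close> and \<open>h\<close> has all moments
  strictly between \<open>0\<close> and \<open>p - 1\<close> equal to zero, while moment \<open>0\<close> is nonzero; such a function is constant
  except at \<open>0\<close>. So \<open>{0}\<close> is a color class, and since the elements of \<open>A\<close> have mean \<open>0\<close>, it is \<open>A\<close>.
\<close>

section \<open>Moment identities on a plane\<close>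

definition moment :: "('a::{field,finite} \<Rightarrow> 'a) \<Rightarrow> nat \<Rightarrow> 'a" where
  "moment f i = (\<Sum>x\<in>UNIV. f x * x ^ i)"

context
  fixes f h :: "'a::{field,finite} \<Rightarrow> 'a"
begin

definition wedge :: "'a \<Rightarrow> 'a \<Rightarrow> 'a" where
  "wedge x y = f x * h y - h x * f y"

definition minor :: "nat \<Rightarrow> nat \<Rightarrow> 'a" where
  "minor i j = moment f i * moment h j - moment h i * moment f j"

definition wedge_sum :: "('a \<Rightarrow> 'a \<Rightarrow> 'a) \<Rightarrow> 'a" where
  "wedge_sum Q = (\<Sum>x\<in>UNIV. \<Sum>y\<in>UNIV. Q x y * wedge x y)"

text \<open>On the plane one variable equals \<open>\<beta> * y + \<gamma> * z + c\<close>. It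
  carries the exponent \<open>s\<close>, the kept variable \<open>y\<close> carries
  \<open>t\<close>, and \<open>z\<close> is unweighted.\<close>

definition affine_sum :: "nat \<Rightarrow> nat \<Rightarrow> 'a \<Rightarrow> 'a \<Rightarrow> 'a \<Rightarrow> 'a" where
  "affine_sum t s \<beta> \<gamma> c = wedge_sum (\<lambda>y z. y ^ t * (\<beta> * y + \<gamma> * z + c) ^ s)"

text \<open>The left-hand side is the determinant with rows \<open>(1, f, h)\<close> at \<open>x\<close>, \<open>y\<close>, \<open>z\<close>, so the
  condition says that the points \<open>(f x, h x)\<close>, \<open>(f y, h y)\<close>, \<open>(f z, h z)\<close> are collinear.\<close>

definition collinear_on :: "'a \<Rightarrow> 'a \<Rightarrow> 'a \<Rightarrow> 'a \<Rightarrow> bool" where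
  "collinear_on a1 a2 a3 b \<longleftrightarrow>
     (\<forall>x y z. a1 * x + a2 * y + a3 * z = b \<longrightarrow> wedge x y + wedge y z + wedge z x = 0)"

lemma wedge_swap: "wedge y x = - wedge x y"
  by (simp add: wedge_def)

lemma minor_swap: "minor j i = - minor i j"
  by (simp add: minor_def)

lemma minor_same [simp]: "minor i i = 0"
  by (simp add: minor_def)

text \<open>The three-term Pluecker relation. It allows a minor to be tested after multiplication by
  a minor known to be nonzero.\<close>

lemma minor_pluecker: "minor i j * minor k l = minor i k * minor j l - minor i l * minor j k"
  unfolding minor_def by (simp add: algebra_simps)

lemma collinear_on_swap12: "collinear_on a1 a2 a3 b \<Longrightarrow> collinear_on a2 a1 a3 b"
  unfolding collinear_on_def
proof (intro allI impI)
  fix x y z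
  assume *: "\<forall>x y z. a1 * x + a2 * y + a3 * z = b \<longrightarrow> wedge x y + wedge y z + wedge z x = 0"
    and eq: "a2 * x + a1 * y + a3 * z = b"
  have "wedge y x + wedge x z + wedge z y = 0"
    using *[rule_format, of y x z] eq by (simp add: ac_simps)
  moreover have "wedge x y + wedge y z + wedge z x = - (wedge y x + wedge x z + wedge z y)"
    by (simp add: wedge_def)
  ultimately show "wedge x y + wedge y z + wedge z x = 0"
    by simp
qed

lemma collinear_on_swap23: "collinear_on a1 a2 a3 b \<Longrightarrow> collinear_on a1 a3 a2 b"
  unfolding collinear_on_def
proof (intro allI impI)
  fix x y z
  assume *: "\<forall>x y z. a1 * x + a2 * y + a3 * z = b \<longrightarrow> wedge x y + wedge y z + wedge z x = 0"
    and eq: "a1 * x + a3 * y + a2 * z = b"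
  have "wedge x z + wedge z y + wedge y x = 0"
    using *[rule_format, of x z y] eq by (simp add: ac_simps)
  moreover have "wedge x y + wedge y z + wedge z x = - (wedge x z + wedge z y + wedge y x)"
    by (simp add: wedge_def)
  ultimately show "wedge x y + wedge y z + wedge z x = 0"
    by simp
qed

text \<open>Each half of \<open>wedge\<close> is a product of a function of \<open>x\<close> and one
  of \<open>y\<close>, so the double sum splits into products of moments.\<close>

lemma wedge_sum_monomial: "wedge_sum (\<lambda>x y. x ^ i * y ^ j) = minor i j"
  unfolding wedge_sum_def minor_def moment_def wedge_def sum_product sum_subtractf[symmetric]
  by (intro sum.cong refl) (simp add: algebra_simps)

lemma wedge_sum_cmult: "wedge_sum (\<lambda>x y. c * Q x y) = c * wedge_sum Q"
  unfolding wedge_sum_def by (simp add: sum_distrib_left ac_simps)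

lemma wedge_sum_sum: "wedge_sum (\<lambda>x y. \<Sum>i\<in>I. Q i x y) = (\<Sum>i\<in>I. wedge_sum (Q i))"
proof -
  have "wedge_sum (\<lambda>x y. \<Sum>i\<in>I. Q i x y) =
      (\<Sum>x\<in>UNIV. \<Sum>y\<in>UNIV. \<Sum>i\<in>I. Q i x y * wedge x y)"
    unfolding wedge_sum_def by (simp add: sum_distrib_right)
  also have "\<dots> = (\<Sum>x\<in>UNIV. \<Sum>i\<in>I. \<Sum>y\<in>UNIV. Q i x y * wedge x y)"
    by (intro sum.cong refl sum.swap)
  also have "\<dots> = (\<Sum>i\<in>I. wedge_sum (Q i))"
    unfolding wedge_sum_def by (rule sum.swap)
  finally show ?thesis .
qed

text \<open>The binomial theorem in \<open>y\<close> and \<open>z\<close>. All minors on the right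
  have index sum \<open>t + s\<close>; this is the degree in which the later arguments are
  organised.\<close>

lemma affine_sum_homogeneous:
  "affine_sum t s \<beta> \<gamma> 0 =
     (\<Sum>j\<le>s. of_nat (s choose j) * \<beta> ^ (s - j) * \<gamma> ^ j * minor (t + (s - j)) j)"
proof -
  have "affine_sum t s \<beta> \<gamma> 0 = wedge_sum (\<lambda>y z. \<Sum>j\<le>s.
      (of_nat (s choose j) * \<beta> ^ (s - j) * \<gamma> ^ j) * (y ^ (t + (s - j)) * z ^ j))"
    unfolding affine_sum_def
  proof (rule arg_cong[of _ _ wedge_sum], intro ext)
    fix y z
    have "(\<beta> * y + \<gamma> * z + 0) ^ s = (\<gamma> * z + \<beta> * y) ^ s"
      by (simp add: add.commute)
    also have "\<dots> = (\<Sum>j\<le>s. of_nat (s choose j) * (\<gamma> * z) ^ j * (\<beta> * y) ^ (s - j))"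
      by (rule binomial_ring)
    finally have "y ^ t * (\<beta> * y + \<gamma> * z + 0) ^ s =
        (\<Sum>j\<le>s. y ^ t * (of_nat (s choose j) * (\<gamma> * z) ^ j * (\<beta> * y) ^ (s - j)))"
      by (simp add: sum_distrib_left)
    also have "\<dots> = (\<Sum>j\<le>s. (of_nat (s choose j) * \<beta> ^ (s - j) * \<gamma> ^ j) * (y ^ (t + (s - j)) * z ^ j))"
      by (intro sum.cong refl) (simp only: power_mult_distrib power_add ac_simps)
    finally show "y ^ t * (\<beta> * y + \<gamma> * z + 0) ^ s =
        (\<Sum>j\<le>s. (of_nat (s choose j) * \<beta> ^ (s - j) * \<gamma> ^ j) * (y ^ (t + (s - j)) * z ^ j))" .
  qed
  then show ?thesis
    by (simp only: wedge_sum_sum wedge_sum_cmult wedge_sum_monomial)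
qed

text \<open>Expansion in powers of \<open>c\<close>: a nonzero constant only adds contributions of
  lower degree.\<close>

lemma affine_sum_expand:
  "affine_sum t s \<beta> \<gamma> c =
     (\<Sum>q\<le>s. of_nat (s choose q) * c ^ (s - q) * affine_sum t q \<beta> \<gamma> 0)"
proof -
  have "affine_sum t s \<beta> \<gamma> c = wedge_sum (\<lambda>y z. \<Sum>q\<le>s.
      (of_nat (s choose q) * c ^ (s - q)) * (y ^ t * (\<beta> * y + \<gamma> * z + 0) ^ q))"
    unfolding affine_sum_def binomial_ring[of "_ + _" c] sum_distrib_left
    by (simp add: ac_simps)
  then show ?thesis
    unfolding affine_sum_def by (simp only: wedge_sum_sum wedge_sum_cmult)
qed

text \<open>Both sides sum \<open>G\<close> over the same plane, parametrised by
  \<open>(x, y)\<close> and by \<open>(y, z)\<close>.\<close>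

lemma sum_plane_first:
  fixes G :: "'a \<Rightarrow> 'a \<Rightarrow> 'a \<Rightarrow> 'a"
  assumes "a1 \<noteq> 0" "a3 \<noteq> 0"
  shows "(\<Sum>x\<in>UNIV. \<Sum>y\<in>UNIV. G x y ((b - a1 * x - a2 * y) / a3)) =
    (\<Sum>y\<in>UNIV. \<Sum>z\<in>UNIV. G ((b - a2 * y - a3 * z) / a1) y z)"
proof -
  have "(\<Sum>x\<in>UNIV. G x y ((b - a1 * x - a2 * y) / a3)) =
      (\<Sum>z\<in>UNIV. G ((b - a2 * y - a3 * z) / a1) y z)" for y
    by (rule sum.reindex_bij_witness[of _ "\<lambda>z. (b - a2 * y - a3 * z) / a1"
          "\<lambda>x. (b - a1 * x - a2 * y) / a3"]) (use assms in simp_all)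
  then show ?thesis
    by (subst sum.swap) simp
qed

lemma sum_plane_second:
  fixes G :: "'a \<Rightarrow> 'a \<Rightarrow> 'a \<Rightarrow> 'a"
  assumes "a2 \<noteq> 0" "a3 \<noteq> 0"
  shows "(\<Sum>x\<in>UNIV. \<Sum>y\<in>UNIV. G x y ((b - a1 * x - a2 * y) / a3)) =
    (\<Sum>x\<in>UNIV. \<Sum>z\<in>UNIV. G x ((b - a1 * x - a3 * z) / a2) z)"
proof (rule sum.cong[OF refl])
  fix x
  show "(\<Sum>y\<in>UNIV. G x y ((b - a1 * x - a2 * y) / a3)) =
      (\<Sum>z\<in>UNIV. G x ((b - a1 * x - a3 * z) / a2) z)"
    by (rule sum.reindex_bij_witness[of _ "\<lambda>z. (b - a1 * x - a3 * z) / a2"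
          "\<lambda>y. (b - a1 * x - a2 * y) / a3"]) (use assms in simp_all)
qed

text \<open>The three terms come from weighting the determinant by \<open>x ^ s * y ^ t\<close>, summing over the plane
  and eliminating in each minor the variable that it does not contain.\<close>

lemma moment_identity:
  assumes col: "collinear_on a1 a2 a3 b" and nz: "a1 \<noteq> 0" "a2 \<noteq> 0" "a3 \<noteq> 0"
  shows "minor s t + affine_sum t s (- a2 / a1) (- a3 / a1) (b / a1)
    - affine_sum s t (- a1 / a2) (- a3 / a2) (b / a2) = 0"
proof -
  define z where "z x y = (b - a1 * x - a2 * y) / a3" for x y
  have "wedge x y + wedge y (z x y) + wedge (z x y) x = 0" for x y
    using col nz unfolding collinear_on_def z_def by simp
  then have "(\<Sum>x\<in>UNIV. \<Sum>y\<in>UNIV. x ^ s * y ^ t * (wedge x y + wedge y (z x y) + wedge (z x y) x)) = 0"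
    by simp
  then have "minor s t + (\<Sum>x\<in>UNIV. \<Sum>y\<in>UNIV. x ^ s * y ^ t * wedge y (z x y))
      + (\<Sum>x\<in>UNIV. \<Sum>y\<in>UNIV. x ^ s * y ^ t * wedge (z x y) x) = 0"
    by (simp add: wedge_sum_monomial[symmetric] wedge_sum_def algebra_simps sum.distrib)
  moreover have "(\<Sum>x\<in>UNIV. \<Sum>y\<in>UNIV. x ^ s * y ^ t * wedge y (z x y)) =
      affine_sum t s (- a2 / a1) (- a3 / a1) (b / a1)"
  proof -
    have "(b - a2 * y - a3 * z) / a1 = - a2 / a1 * y + - a3 / a1 * z + b / a1" for y z
      using nz by (simp add: field_simps)
    then show ?thesis
      unfolding z_def sum_plane_first[OF nz(1,3), of "\<lambda>x y z. x ^ s * y ^ t * wedge y z"]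
        affine_sum_def wedge_sum_def by (simp add: ac_simps)
  qed
  moreover have "(\<Sum>x\<in>UNIV. \<Sum>y\<in>UNIV. x ^ s * y ^ t * wedge (z x y) x) =
      - affine_sum s t (- a1 / a2) (- a3 / a2) (b / a2)"
  proof -
    have eq: "(b - a1 * x - a3 * z) / a2 = - a1 / a2 * x + - a3 / a2 * z + b / a2" for x z
      using nz by (simp add: field_simps)
    have "(\<Sum>x\<in>UNIV. \<Sum>y\<in>UNIV. x ^ s * y ^ t * wedge (z x y) x) =
        (\<Sum>x\<in>UNIV. \<Sum>z\<in>UNIV. x ^ s * ((b - a1 * x - a3 * z) / a2) ^ t * wedge z x)"
      unfolding z_def by (rule sum_plane_second[OF nz(2,3), of "\<lambda>x y z. x ^ s * y ^ t * wedge z x"])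
    also have "\<dots> = (\<Sum>x\<in>UNIV. \<Sum>z\<in>UNIV.
        - (x ^ s * (- a1 / a2 * x + - a3 / a2 * z + b / a2) ^ t * wedge x z))"
      by (intro sum.cong refl) (subst wedge_swap, simp only: eq mult_minus_right)
    also have "\<dots> = - affine_sum s t (- a1 / a2) (- a3 / a2) (b / a2)"
      unfolding affine_sum_def wedge_sum_def by (simp only: sum_negf)
    finally show ?thesis .
  qed
  ultimately show ?thesis
    by simp
qed

end

section \<open>Relations in degrees 1, K and K + 1\<close>

lemma affine_sum_0 [simp]: "affine_sum f h t 0 \<beta> \<gamma> c = minor f h t 0"
  using affine_sum_expand[of f h t 0 \<beta> \<gamma> c] affine_sum_homogeneous[of f h t 0 \<beta> \<gamma>] by simp

lemma affine_sum_1: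
  "affine_sum f h t 1 \<beta> \<gamma> c = \<beta> * minor f h (Suc t) 0 + \<gamma> * minor f h t 1 + c * minor f h t 0"
  using affine_sum_expand[of f h t 1 \<beta> \<gamma> c] affine_sum_homogeneous[of f h t 1 \<beta> \<gamma>] by simp

text \<open>For \<open>s = 1\<close>, \<open>t = 0\<close> the identity collapses to
  \<open>(a2 - a3) * minor f h 0 1 = 0\<close>, up to a nonzero factor.\<close>

lemma minor_0_1_eq_0_aux:
  assumes col: "collinear_on f h a1 a2 a3 b" and nz: "a1 \<noteq> 0" "a2 \<noteq> 0" "a3 \<noteq> 0"
    and "a2 \<noteq> a3"
  shows "minor f h 0 1 = 0"
proof -
  have "minor f h 1 0 + (- a2 / a1 * minor f h 1 0 + - a3 / a1 * minor f h 0 1) - minor f h 1 0 = 0"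
    using moment_identity[OF col nz, of 1 0] by (simp add: affine_sum_1[unfolded One_nat_def])
  then have "(a2 - a3) * minor f h 0 1 = 0"
    unfolding minor_swap[of f h 1 0] using nz by (simp add: field_simps)
  then show ?thesis
    using \<open>a2 \<noteq> a3\<close> by simp
qed

lemma minor_0_1_eq_0:
  assumes col: "collinear_on f h a1 a2 a3 b" and nz: "a1 \<noteq> 0" "a2 \<noteq> 0" "a3 \<noteq> 0"
    and ne: "\<not> (a1 = a2 \<and> a2 = a3)"
  shows "minor f h 0 1 = 0"
proof (cases "a2 = a3")
  case False
  then show ?thesis
    using minor_0_1_eq_0_aux[OF col nz] by simp
next
  case True
  then have "a1 \<noteq> a3"
    using ne by auto
  then show ?thesis
    using minor_0_1_eq_0_aux[OF collinear_on_swap12[OF col] nz(2,1,3)] by simp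
qed

text \<open>In the matrix with rows the moments of \<open>f\<close> and of \<open>h\<close>, column
  0 is nonzero. Columns \<open>i\<close> and \<open>j\<close> are multiples of it, hence
  proportional to each other.\<close>

lemma minor_below:
  assumes nz: "moment f 0 \<noteq> 0 \<or> moment h 0 \<noteq> 0"
    and "minor f h 0 i = 0" "minor f h 0 j = 0"
  shows "minor f h i j = 0"
proof -
  have "moment f 0 * minor f h i j = moment f i * minor f h 0 j - moment f j * minor f h 0 i"
    "moment h 0 * minor f h i j = moment h i * minor f h 0 j - moment h j * minor f h 0 i"
    by (simp_all add: minor_def algebra_simps)
  then show ?thesis
    using assms by auto
qed

lemma affine_sum_degree_less:
  assumes low: "\<And>i j. i < K \<Longrightarrow> j < K \<Longrightarrow> minor f h i j = 0" and "t + s < K"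
  shows "affine_sum f h t s \<beta> \<gamma> 0 = 0"
  unfolding affine_sum_homogeneous by (rule sum.neutral) (use assms in auto)

text \<open>In degree \<open>K\<close> a minor survives only if one of its indices is 0; with the
  weight \<open>y\<close> this leaves the term \<open>j = 0\<close>. The terms brought in by
  \<open>c\<close> have degree below \<open>K\<close> and vanish.\<close>

lemma affine_sum_leading:
  assumes low: "\<And>i j. i < K \<Longrightarrow> j < K \<Longrightarrow> minor f h i j = 0" and K: "K = Suc s" "s > 0"
  shows "affine_sum f h 1 s \<beta> \<gamma> c = - (\<beta> ^ s * minor f h 0 K)"
proof -
  have "affine_sum f h 1 s \<beta> \<gamma> c = affine_sum f h 1 s \<beta> \<gamma> 0"
    unfolding affine_sum_expand[of f h 1 s \<beta> \<gamma> c]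
    by (subst sum.remove[of _ s])
      (auto intro!: sum.neutral affine_sum_degree_less[OF low] simp: K)
  also have "\<dots> = \<beta> ^ s * minor f h K 0"
    unfolding affine_sum_homogeneous
    by (subst sum.remove[of _ 0]) (auto intro!: sum.neutral low simp: K)
  finally show ?thesis
    by (subst (asm) minor_swap) simp
qed

text \<open>With the weight \<open>x * y ^ (K - 1)\<close> only \<open>minor f h 0 K\<close>
  survives, with coefficient \<open>a2 / a1 + (- a1 / a2) ^ (K - 1)\<close>. Setting this to 0 and
  multiplying by \<open>- a1 / a2\<close> gives the claim.\<close>

lemma ratio_power_eq_1:
  assumes col: "collinear_on f h a1 a2 a3 b" and nz: "a1 \<noteq> 0" "a2 \<noteq> 0" "a3 \<noteq> 0"
    and low: "\<And>i j. i < K \<Longrightarrow> j < K \<Longrightarrow> minor f h i j = 0" and K: "K > 1"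
    and T: "minor f h 0 K \<noteq> 0"
  shows "(- a1 / a2) ^ K = 1"
proof -
  obtain s where s: "K = Suc s" "s > 0"
    using K by (cases K) auto
  have "minor f h K 0 = - minor f h 0 K"
    by (rule minor_swap)
  then have "a2 / a1 * minor f h 0 K + (- a1 / a2) ^ s * minor f h 0 K = 0"
    using moment_identity[OF col nz, of 1 s] affine_sum_1[of f h s "- a2 / a1" "- a3 / a1" "b / a1"]
      affine_sum_leading[OF low s, of "- a1 / a2" "- a3 / a2" "b / a2"] s
      low[of 1 s] low[of s 1] low[of s 0] by simp
  then have "(a2 / a1 + (- a1 / a2) ^ s) * minor f h 0 K = 0"
    by (simp only: distrib_right)
  then have "a2 / a1 + (- a1 / a2) ^ s = 0"
    using T by simp
  then have "(- a1 / a2) ^ s = - (a2 / a1)"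
    by (simp add: eq_neg_iff_add_eq_0 add.commute)
  then show ?thesis
    using nz s by simp
qed

text \<open>The weight \<open>x * y ^ K\<close> has degree \<open>K + 1\<close>, where
  \<open>minor f h 0 (Suc K)\<close> is the only new unknown because
  \<open>minor f h 1 K = 0\<close>. The offset enters through degree \<open>K\<close>: once from one
  affine sum and \<open>K\<close> times from the other, whence the factor
  \<open>Suc K\<close>.\<close>

lemma offset_eq:
  assumes col: "collinear_on f h a1 a2 a3 b" and nz: "a1 \<noteq> 0" "a2 \<noteq> 0" "a3 \<noteq> 0"
    and low: "\<And>i j. i < K \<Longrightarrow> j < K \<Longrightarrow> minor f h i j = 0" and K: "K > 1"
    and T: "minor f h 0 K \<noteq> 0" and one: "minor f h 1 K = 0"
  shows "(a1 + a2) * minor f h 0 (Suc K) = of_nat (Suc K) * b * minor f h 0 K"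
proof -
  obtain s where s: "K = Suc s" "s > 0"
    using K by (cases K) auto
  let ?r = "- a1 / a2" and ?g = "- a3 / a2"
  have r: "?r ^ K = 1"
    by (rule ratio_power_eq_1[OF col nz low K T])
  then have rs: "?r ^ s = - (a2 / a1)"
    using s nz by (simp add: field_simps) (metis minus_minus)
  have swap: "minor f h K 0 = - minor f h 0 K" "minor f h (Suc K) 0 = - minor f h 0 (Suc K)"
    "minor f h K 1 = 0"
    using minor_swap[of f h K 1] one minor_swap[of f h K 0] minor_swap[of f h "Suc K" 0] by auto
  have top: "affine_sum f h 1 K ?r ?g 0 = - minor f h 0 (Suc K)"
  proof -
    have "affine_sum f h 1 K ?r ?g 0 = ?r ^ K * minor f h (Suc K) 0"
      unfolding affine_sum_homogeneous
    proof (subst sum.remove[of _ 0])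
      have "minor f h (1 + (K - j)) j = 0" if j: "j \<in> {..K} - {0}" for j
      proof -
        consider "j = 1" | "j = K" | "1 + (K - j) < K" "j < K"
          using j by atomize_elim auto
        then show ?thesis
          by cases (use one swap K low in auto)
      qed
      then have "(\<Sum>j\<in>{..K} - {0}. of_nat (K choose j) * ?r ^ (K - j) * ?g ^ j *
          minor f h (1 + (K - j)) j) = 0"
        by (intro sum.neutral) simp
      then show "of_nat (K choose 0) * ?r ^ (K - 0) * ?g ^ 0 * minor f h (1 + (K - 0)) 0 +
          (\<Sum>j\<in>{..K} - {0}. of_nat (K choose j) * ?r ^ (K - j) * ?g ^ j *
            minor f h (1 + (K - j)) j) = ?r ^ K * minor f h (Suc K) 0"
        by simp
    qed auto
    then show ?thesis
      using r swap by simp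
  qed
  have lead: "affine_sum f h 1 s ?r ?g 0 = a2 / a1 * minor f h 0 K"
    using affine_sum_leading[of K f h s ?r ?g 0] low s rs by simp
  have lower: "affine_sum f h 1 q ?r ?g 0 = 0" if "q < s" for q
    by (rule affine_sum_degree_less[of K]) (use low that s in auto)
  have rest: "(\<Sum>q\<in>{..s} - {s}. of_nat (Suc s choose q) * (b / a2) ^ (Suc s - q) *
      affine_sum f h 1 q ?r ?g 0) = 0"
    by (intro sum.neutral ballI, subst lower) auto
  \<comment> \<open>Only \<open>q = K\<close> and \<open>q = K - 1\<close> contribute, so the offset
    appears to first order only.\<close>
  have "affine_sum f h 1 K ?r ?g (b / a2) =
      of_nat (K choose s) * (b / a2) ^ (K - s) * affine_sum f h 1 s ?r ?g 0 + affine_sum f h 1 K ?r ?g 0"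
    unfolding affine_sum_expand[of f h 1 K ?r ?g "b / a2"] unfolding s(1) sum.atMost_Suc
    by (subst sum.remove[of _ s]) (simp_all only: rest add_0_right finite_atMost atMost_iff order_refl binomial_n_n
          diff_self_eq_0 power_0 mult_1 of_nat_1)
  also have "\<dots> = of_nat K * (b / a1) * minor f h 0 K - minor f h 0 (Suc K)"
    unfolding top lead using nz s by (simp add: field_simps)
  finally have "a2 / a1 * minor f h 0 (Suc K) - b / a1 * minor f h 0 K
      - (of_nat K * (b / a1) * minor f h 0 K - minor f h 0 (Suc K)) = 0"
    using moment_identity[OF col nz, of 1 K] affine_sum_1[of f h K "- a2 / a1" "- a3 / a1" "b / a1"]
      swap one by simp
  then have "a1 * ((a1 + a2) * minor f h 0 (Suc K)) = a1 * (of_nat (Suc K) * b * minor f h 0 K)"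
    using nz by (simp add: field_simps)
  then show ?thesis
    using nz by simp
qed

text \<open>Under these assumptions the only independent minors of total degree \<open>K + \<delta>\<close> that can be nonzero
  are \<open>minor f h 0 (K + \<delta>)\<close> and \<open>minor f h \<delta> K\<close>.\<close>

locale sparse_degree =
  fixes f h :: "'a::{field,finite} \<Rightarrow> 'a" and K \<delta> :: nat
  assumes low: "\<And>i. i < K \<Longrightarrow> minor f h 0 i = 0" and T: "minor f h 0 K \<noteq> 0"
    and prev: "\<And>i. 0 < i \<Longrightarrow> i < \<delta> \<Longrightarrow> minor f h i K = 0"
    and pos: "0 < K" "0 < \<delta>" "\<delta> \<noteq> K"
begin

text \<open>Multiply by \<open>minor f h 0 K\<close> and apply the Pluecker relation. In its first
  product, \<open>low\<close> applies if \<open>i < K\<close>; if \<open>i > K\<close>, then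
  \<open>j < \<delta>\<close> and \<open>prev\<close> applies. The second product is treated in the
  same way with \<open>i\<close> and \<open>j\<close> exchanged.\<close>

lemma minor_middle:
  assumes "0 < i" "0 < j" "i + j = K + \<delta>" "i \<noteq> \<delta>" "i \<noteq> K"
  shows "minor f h i j = 0"
proof -
  have "minor f h 0 i * minor f h K j = 0"
    using low[of i] prev[of j] assms minor_swap[of f h K j] by (cases "i < K") auto
  moreover have "minor f h 0 j * minor f h K i = 0"
    using low[of j] prev[of i] assms minor_swap[of f h K i] by (cases "j < K") auto
  moreover have "minor f h 0 K * minor f h i j =
      minor f h 0 i * minor f h K j - minor f h 0 j * minor f h K i"
    by (rule minor_pluecker)
  ultimately show ?thesis
    using T by (metis diff_self mult_eq_0_iff)
qed

lemma affine_sum_sparse: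
  assumes st: "s + t = K + \<delta>"
  shows "affine_sum f h t s \<beta> \<gamma> 0 =
    - (\<beta> ^ s * minor f h 0 (K + \<delta>))
    + of_nat (s choose K) * \<beta> ^ (s - K) * \<gamma> ^ K * minor f h \<delta> K
    - of_nat (s choose \<delta>) * \<beta> ^ (s - \<delta>) * \<gamma> ^ \<delta> * minor f h \<delta> K
    + (if t = 0 then \<gamma> ^ s * minor f h 0 (K + \<delta>) else 0)"
proof -
  let ?g = "\<lambda>j. of_nat (s choose j) * \<beta> ^ (s - j) * \<gamma> ^ j"
  let ?u = "minor f h 0 (K + \<delta>)" and ?v = "minor f h \<delta> K"
  \<comment> \<open>The four exceptional positions \<open>j = 0\<close>, \<open>j = K\<close>,
    \<open>j = \<delta>\<close> and, for \<open>t = 0\<close>, \<open>j = s\<close> are pairwise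
    distinct; \<open>minor_middle\<close> covers all others.\<close>
  have "?g j * minor f h (t + (s - j)) j =
      (if j = 0 then - (\<beta> ^ s * ?u) else 0) + (if j = K then ?g K * ?v else 0)
      + (if j = \<delta> then - ?g \<delta> * ?v else 0) + (if j = s \<and> t = 0 then \<gamma> ^ s * ?u else 0)"
    if "j \<le> s" for j
  proof -
    have sum: "t + (s - j) + j = K + \<delta>"
      using that st by simp
    consider "j = 0" | "j = K" | "j = \<delta>" | "t + (s - j) = 0" | "0 < j" "j \<noteq> K" "j \<noteq> \<delta>" "0 < t + (s - j)"
      by (metis gr0I)
    then show ?thesis
    proof cases
      case 1
      then show ?thesis
        using pos st minor_swap[of f h "t + s" 0] by (auto simp: add.commute)
    next
      case 2
      then have "t + (s - j) = \<delta>"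
        using sum by simp
      then show ?thesis
        using 2 pos st by auto
    next
      case 3
      then have "t + (s - j) = K"
        using sum by simp
      then show ?thesis
        using 3 pos st minor_swap[of f h K \<delta>] by auto
    next
      case 4
      then have "t = 0" "j = s" "s = K + \<delta>"
        using that st by auto
      then show ?thesis
        using pos by auto
    next
      case 5
      then show ?thesis
        using minor_middle[of "t + (s - j)" j] sum by auto
    qed
  qed
  then have "affine_sum f h t s \<beta> \<gamma> 0 = (\<Sum>j\<le>s. (if j = 0 then - (\<beta> ^ s * ?u) else 0)
      + (if j = K then ?g K * ?v else 0) + (if j = \<delta> then - ?g \<delta> * ?v else 0)
      + (if j = s \<and> t = 0 then \<gamma> ^ s * ?u else 0))"
    unfolding affine_sum_homogeneous by (intro sum.cong) auto
  also have "\<dots> = - (\<beta> ^ s * ?u) + (if K \<le> s then ?g K * ?v else 0)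
      + (if \<delta> \<le> s then - ?g \<delta> * ?v else 0) + (if t = 0 then \<gamma> ^ s * ?u else 0)"
    by (cases "t = 0") (simp_all add: sum.distrib)
  \<comment> \<open>The case distinctions disappear because the binomial coefficient is 0 whenever
    \<open>s - K\<close> or \<open>s - \<delta>\<close> is truncated.\<close>
  also have "\<dots> = - (\<beta> ^ s * ?u) + ?g K * ?v - ?g \<delta> * ?v + (if t = 0 then \<gamma> ^ s * ?u else 0)"
    by (auto simp: not_le binomial_eq_0)
  finally show ?thesis .
qed


text \<open>All \<open>K\<close>-th powers of the ratios are 1, so each term of the moment identity,
  multiplied by \<open>a2 ^ \<delta>\<close>, is \<open>(- a2 / a1) ^ s\<close> times an expression
  in the \<open>\<delta>\<close>-th powers of the coefficients. The common factor is then
  cancelled.\<close>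

lemma interior_identity:
  assumes col: "collinear_on f h a1 a2 a3 0" and nz: "a1 \<noteq> 0" "a2 \<noteq> 0" "a3 \<noteq> 0"
    and K: "even K" "a1 ^ K = a2 ^ K" "a3 ^ K = a2 ^ K"
    and st: "0 < s" "0 < t" "s + t = K + \<delta>" "s \<noteq> K"
  shows "minor f h 0 (K + \<delta>) * ((-1) ^ \<delta> * a1 ^ \<delta> - a2 ^ \<delta>)
    + minor f h \<delta> K * (of_nat (s choose K) * a2 ^ \<delta> - of_nat (s choose \<delta>) * a3 ^ \<delta>
      + (-1) ^ \<delta> * of_nat (t choose \<delta>) * a3 ^ \<delta>
      - (if t = K then 0 else (-1) ^ \<delta> * of_nat (t choose K) * a1 ^ \<delta>)) = 0"
    (is "?u * _ + ?v * _ = 0")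
proof -
  define r g q k where "r = - a2 / a1" and "g = - a3 / a1" and "q = - a1 / a2" and "k = - a3 / a2"
  note defs = r_def g_def q_def k_def
  let ?\<epsilon> = "(-1) ^ \<delta> :: 'a"
  have pK: "r ^ K = 1" "g ^ K = 1" "q ^ K = 1" "k ^ K = 1"
    using nz K by (simp_all add: defs power_divide)
  have rq: "r * q = 1" and r0: "r \<noteq> 0"
    using nz by (simp_all add: defs)
  \<comment> \<open>From \<open>r * q = 1\<close>, \<open>s + t = K + \<delta>\<close> and
    \<open>q ^ K = 1\<close>; this extracts the common factor \<open>r ^ s\<close> from powers of
    \<open>q\<close>.\<close>
  have "q ^ t = (r * q) ^ s * q ^ t"
    by (simp add: rq)
  also have "\<dots> = r ^ s * q ^ (K + \<delta>)"
    using st by (simp add: power_mult_distrib flip: st(3)) (simp add: power_add ac_simps)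
  finally have qt: "q ^ t = r ^ s * q ^ \<delta>"
    by (simp add: power_add pK)
  have minus_pow: "(- (x / y)) ^ \<delta> = ?\<epsilon> * x ^ \<delta> / y ^ \<delta>" for x y :: 'a
    by (subst power_minus) (simp add: power_divide)
  have eps: "?\<epsilon> * ?\<epsilon> = 1"
    by (simp flip: power_mult_distrib)
  have q\<delta>: "q ^ \<delta> * a2 ^ \<delta> = ?\<epsilon> * a1 ^ \<delta>"
    using nz by (simp add: q_def minus_pow)
  have qt': "q ^ t * a2 ^ \<delta> = r ^ s * (?\<epsilon> * a1 ^ \<delta>)"
    unfolding qt by (simp add: mult.assoc q\<delta>)
  have t1: "of_nat (s choose K) * r ^ (s - K) * g ^ K = of_nat (s choose K) * r ^ s"
  proof (cases "K \<le> s")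
    case True
    then have "r ^ s = r ^ (s - K) * r ^ K"
      by (simp flip: power_add)
    then show ?thesis
      by (simp add: pK)
  qed (simp add: binomial_eq_0)
  have t2: "of_nat (s choose \<delta>) * r ^ (s - \<delta>) * g ^ \<delta> * a2 ^ \<delta> = of_nat (s choose \<delta>) * r ^ s * a3 ^ \<delta>"
  proof (cases "\<delta> \<le> s")
    case True
    then have "r ^ s = r ^ (s - \<delta>) * r ^ \<delta>"
      by (simp flip: power_add)
    moreover have "r ^ \<delta> * a3 ^ \<delta> = g ^ \<delta> * a2 ^ \<delta>"
      by (simp add: r_def g_def minus_pow)
    ultimately show ?thesis
      by (simp add: ac_simps)
  qed (simp add: binomial_eq_0)
  have t3: "of_nat (t choose K) * q ^ (t - K) * k ^ K = of_nat (t choose K) * q ^ t"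
  proof (cases "K \<le> t")
    case True
    then have "q ^ t = q ^ (t - K) * q ^ K"
      by (simp flip: power_add)
    then show ?thesis
      by (simp add: pK)
  qed (simp add: binomial_eq_0)
  have t4: "of_nat (t choose \<delta>) * q ^ (t - \<delta>) * k ^ \<delta> * a2 ^ \<delta> =
      of_nat (t choose \<delta>) * r ^ s * (?\<epsilon> * a3 ^ \<delta>)"
  proof (cases "\<delta> \<le> t")
    case True
    then have qd: "q ^ t = q ^ (t - \<delta>) * q ^ \<delta>"
      by (simp flip: power_add)
    have "q ^ \<delta> * q ^ (t - \<delta>) = q ^ \<delta> * r ^ s"
      using qt qd by (simp add: ac_simps)
    then have "q ^ (t - \<delta>) = r ^ s"
      using rq by auto
    moreover have "k ^ \<delta> * a2 ^ \<delta> = ?\<epsilon> * a3 ^ \<delta>"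
      using nz by (simp add: k_def minus_pow)
    ultimately show ?thesis
      by (simp add: mult.assoc)
  qed (simp add: binomial_eq_0)
  have "minor f h s t + affine_sum f h t s r g 0 - affine_sum f h s t q k 0 = 0"
    using moment_identity[OF col nz, of s t] by (simp add: defs)
  then have main: "minor f h s t * a2 ^ \<delta> + affine_sum f h t s r g 0 * a2 ^ \<delta>
      - affine_sum f h s t q k 0 * a2 ^ \<delta> = 0"
    by (metis left_diff_distrib distrib_right mult_zero_left)
  have E1: "affine_sum f h t s r g 0 * a2 ^ \<delta> =
      r ^ s * (- ?u * a2 ^ \<delta> + of_nat (s choose K) * ?v * a2 ^ \<delta> - of_nat (s choose \<delta>) * a3 ^ \<delta> * ?v)"
  proof -
    have "affine_sum f h t s r g 0 * a2 ^ \<delta> = - (r ^ s * ?u * a2 ^ \<delta>)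
        + of_nat (s choose K) * r ^ (s - K) * g ^ K * ?v * a2 ^ \<delta>
        - of_nat (s choose \<delta>) * r ^ (s - \<delta>) * g ^ \<delta> * a2 ^ \<delta> * ?v"
      unfolding affine_sum_sparse[OF st(3)] using st by (simp add: algebra_simps)
    then show ?thesis
      unfolding t1 t2 by (simp add: algebra_simps)
  qed
  have E2: "affine_sum f h s t q k 0 * a2 ^ \<delta> =
      r ^ s * (- ?u * (?\<epsilon> * a1 ^ \<delta>) + of_nat (t choose K) * ?v * (?\<epsilon> * a1 ^ \<delta>)
        - of_nat (t choose \<delta>) * (?\<epsilon> * a3 ^ \<delta>) * ?v)"
  proof -
    have "affine_sum f h s t q k 0 * a2 ^ \<delta> = - (q ^ t * a2 ^ \<delta> * ?u)
        + of_nat (t choose K) * q ^ (t - K) * k ^ K * a2 ^ \<delta> * ?v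
        - of_nat (t choose \<delta>) * q ^ (t - \<delta>) * k ^ \<delta> * a2 ^ \<delta> * ?v"
      unfolding affine_sum_sparse[OF st(3)[unfolded add.commute[of s t]]] using st
      by (simp add: algebra_simps)
    also have "\<dots> = - (q ^ t * a2 ^ \<delta> * ?u) + of_nat (t choose K) * (q ^ t * a2 ^ \<delta>) * ?v
        - of_nat (t choose \<delta>) * r ^ s * (?\<epsilon> * a3 ^ \<delta>) * ?v"
      unfolding t3 t4 by (simp add: ac_simps)
    finally show ?thesis
      unfolding qt' by (simp add: algebra_simps)
  qed
  \<comment> \<open>If \<open>t = K\<close>, then \<open>s = \<delta>\<close> and this minor is
    \<open>?v\<close>. It cancels the term with \<open>t choose K = 1\<close> in \<open>E2\<close>,
    which explains the conditional in the statement.\<close>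
  have E3: "minor f h s t * a2 ^ \<delta> = r ^ s * (if t = K then ?\<epsilon> * a1 ^ \<delta> * ?v else 0)"
  proof (cases "t = K")
    case True
    then have "s = \<delta>"
      using st by simp
    have "r ^ \<delta> * (?\<epsilon> * a1 ^ \<delta>) = (?\<epsilon> * ?\<epsilon>) * a2 ^ \<delta>"
      using nz by (simp add: r_def minus_pow)
    then have "a2 ^ \<delta> = r ^ \<delta> * (?\<epsilon> * a1 ^ \<delta>)"
      by (simp only: eps mult_1)
    then show ?thesis
      unfolding True \<open>s = \<delta>\<close> by (simp add: ac_simps)
  next
    case False
    then show ?thesis
      using minor_middle[of s t] st by auto
  qed
  have "r ^ s * (?u * (?\<epsilon> * a1 ^ \<delta> - a2 ^ \<delta>)
    + ?v * (of_nat (s choose K) * a2 ^ \<delta> - of_nat (s choose \<delta>) * a3 ^ \<delta>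
      + ?\<epsilon> * of_nat (t choose \<delta>) * a3 ^ \<delta>
      - (if t = K then 0 else ?\<epsilon> * of_nat (t choose K) * a1 ^ \<delta>))) = 0"
    using main unfolding E1 E2 E3 by (cases "t = K") (simp_all add: algebra_simps)
  then show ?thesis
    using r0 by simp
qed

text \<open>The weight is \<open>y ^ (K + \<delta>)\<close>. The first two terms of the moment
  identity cancel by antisymmetry, and the remaining affine sum factors because
  \<open>K + \<delta> choose K\<close> and \<open>K + \<delta> choose \<delta>\<close>
  agree.\<close>

lemma boundary_identity:
  assumes col: "collinear_on f h a1 a2 a3 0" and nz: "a1 \<noteq> 0" "a2 \<noteq> 0" "a3 \<noteq> 0"
    and K: "even K" "a1 ^ K = a2 ^ K" "a3 ^ K = a2 ^ K"
  shows "(minor f h 0 (K + \<delta>) - of_nat (K + \<delta> choose \<delta>) * minor f h \<delta> K)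
    * (a3 ^ \<delta> - a1 ^ \<delta>) = 0"
    (is "(?u - ?C * ?v) * _ = 0")
proof -
  define q k where "q = - a1 / a2" and "k = - a3 / a2"
  let ?\<epsilon> = "(-1) ^ \<delta> :: 'a"
  have pK: "q ^ K = 1" "k ^ K = 1"
    using nz K by (simp_all add: q_def k_def power_divide)
  have "affine_sum f h 0 (K + \<delta>) q k 0 = 0"
    using moment_identity[OF col nz, of 0 "K + \<delta>"] minor_swap[of f h "K + \<delta>" 0]
    by (simp add: q_def k_def)
  moreover have "K + \<delta> choose K = (K + \<delta> choose \<delta>)"
    using binomial_symmetric[of K "K + \<delta>"] by simp
  ultimately have "- (q ^ \<delta> * ?u) + ?C * q ^ \<delta> * ?v - ?C * k ^ \<delta> * ?v + k ^ \<delta> * ?u = 0"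
    using affine_sum_sparse[of "K + \<delta>" 0 q k] by (simp add: power_add pK)
  then have "(k ^ \<delta> - q ^ \<delta>) * (?u - ?C * ?v) = 0"
    by (simp add: algebra_simps)
  moreover have "k ^ \<delta> - q ^ \<delta> = ?\<epsilon> / a2 ^ \<delta> * (a3 ^ \<delta> - a1 ^ \<delta>)"
    unfolding q_def k_def by (simp only: power_divide power_minus[of a1] power_minus[of a3])
      (simp add: algebra_simps diff_divide_distrib)
  ultimately show ?thesis
    using nz by auto
qed

end

section \<open>Vanishing of minors over a prime field\<close>

lemma of_nat_mod_ring_eq_0_iff: "of_nat n = (0 :: 'p::prime_card mod_ring) \<longleftrightarrow> CARD('p) dvd n"
  using of_nat_eq_0_iff_char_dvd[of n, where 'a = "'p mod_ring"] by simp

lemma of_nat_mod_ring_neq_0: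
  "0 < n \<Longrightarrow> n < CARD('p) \<Longrightarrow> of_nat n \<noteq> (0 :: 'p::prime_card mod_ring)"
  by (auto simp: of_nat_mod_ring_eq_0_iff dest: dvd_imp_le)

lemma of_nat_mod_ring_inj:
  assumes "m < CARD('p)" "n < CARD('p)" "of_nat m = (of_nat n :: 'p::prime_card mod_ring)"
  shows "m = n"
  using assms
proof (induction m n rule: linorder_wlog)
  case (le m n)
  then have "of_nat (n - m) = (0 :: 'p mod_ring)"
    by (simp add: of_nat_diff)
  moreover have "n - m < CARD('p)"
    using le by (simp add: less_imp_diff_less)
  ultimately show ?case
    using of_nat_mod_ring_neq_0[of "n - m", where 'p = 'p] le by (cases "m = n") simp_all
qed auto

lemma of_nat_choose_neq_0:
  assumes "n < CARD('p)" "k \<le> n"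
  shows "of_nat (n choose k) \<noteq> (0 :: 'p::prime_card mod_ring)"
proof
  assume "of_nat (n choose k) = (0 :: 'p mod_ring)"
  then have "CARD('p) dvd n choose k"
    by (simp add: of_nat_mod_ring_eq_0_iff)
  then have "CARD('p) dvd fact n"
    using binomial_fact_lemma[OF assms(2)] by (metis dvd_mult)
  then show False
    using assms(1) prime_card[where 'a = 'p] by (simp add: prime_dvd_fact_iff)
qed

text \<open>By Pascal's rule, neighbouring entries of row \<open>CARD('p) - 1\<close> add up to an
  entry of row \<open>CARD('p)\<close>, which is 0 modulo the prime.\<close>

lemma of_nat_choose_CARD_minus_1:
  "k < CARD('p) \<Longrightarrow> of_nat ((CARD('p) - 1) choose k) = ((-1) ^ k :: 'p::prime_card mod_ring)"
proof (induction k)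
  case (Suc k)
  have p: "Suc (CARD('p) - 1) = CARD('p)"
    using Suc.prems by simp
  have "CARD('p) dvd (CARD('p) choose Suc k)"
    using Suc.prems prime_card[where 'a = 'p] by (intro dvd_choose_prime) auto
  then have "of_nat (((CARD('p) - 1) choose k) + ((CARD('p) - 1) choose Suc k)) = (0 :: 'p mod_ring)"
    unfolding of_nat_mod_ring_eq_0_iff using binomial_Suc_Suc[of "CARD('p) - 1" k] p by simp
  then show ?case
    using Suc by (simp add: add_eq_0_iff)
qed simp

lemma of_nat_choose_CARD_minus_2:
  "k + 2 \<le> CARD('p) \<Longrightarrow>
    of_nat ((CARD('p) - 2) choose k) = ((-1) ^ k * of_nat (Suc k) :: 'p::prime_card mod_ring)"
proof (induction k)
  case (Suc k)
  have p: "Suc (CARD('p) - 2) = CARD('p) - 1"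
    using Suc.prems by simp
  have "of_nat (((CARD('p) - 2) choose k) + ((CARD('p) - 2) choose Suc k)) = ((-1) ^ Suc k :: 'p mod_ring)"
    using of_nat_choose_CARD_minus_1[of "Suc k", where 'p = 'p] Suc.prems
      binomial_Suc_Suc[of "CARD('p) - 2" k] p by simp
  then have "of_nat ((CARD('p) - 2) choose Suc k) =
      ((-1) ^ Suc k - (-1) ^ k * of_nat (Suc k) :: 'p mod_ring)"
    using Suc by (simp add: eq_diff_eq add.commute)
  then show ?case
    by (simp add: algebra_simps)
qed simp

section \<open>Permuted coefficients and the induction step\<close>

definition orderings :: "'a \<Rightarrow> 'a \<Rightarrow> 'a \<Rightarrow> ('a \<times> 'a \<times> 'a) set" where
  "orderings x y z = {(x, y, z), (x, z, y), (y, x, z), (y, z, x), (z, x, y), (z, y, x)}"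

lemma collinear_on_orderings:
  assumes "collinear_on f h a1 a2 a3 b" "(x, y, z) \<in> orderings a1 a2 a3"
  shows "collinear_on f h x y z b"
  using assms collinear_on_swap12[of f h] collinear_on_swap23[of f h]
  unfolding orderings_def by blast

text \<open>Subtracting two of the equations that differ by a transposition gives, for instance,
  \<open>(P - Q) * (x - y) = 0\<close>; some difference of \<open>x\<close>, \<open>y\<close>,
  \<open>z\<close> is nonzero.\<close>

lemma symmetric_linear_form:
  fixes x y z P Q R :: "'a::field"
  assumes eq: "\<And>x' y' z'. (x', y', z') \<in> orderings x y z \<Longrightarrow> P * x' + Q * y' + R * z' = 0"
    and ne: "\<not> (x = y \<and> y = z)"
  shows "P = Q \<and> Q = R"
proof -
  have *: "P * x + Q * y + R * z = 0" "P * x + Q * z + R * y = 0" "P * y + Q * x + R * z = 0"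
    "P * y + Q * z + R * x = 0" "P * z + Q * x + R * y = 0" "P * z + Q * y + R * x = 0"
    by (rule eq, simp add: orderings_def)+
  have "(P - Q) * (x - y) = (P * x + Q * y + R * z) - (P * y + Q * x + R * z)"
    "(P - Q) * (x - z) = (P * x + Q * z + R * y) - (P * z + Q * x + R * y)"
    "(P - Q) * (y - z) = (P * y + Q * z + R * x) - (P * z + Q * y + R * x)"
    "(Q - R) * (x - y) = (P * z + Q * x + R * y) - (P * z + Q * y + R * x)"
    "(Q - R) * (x - z) = (P * y + Q * x + R * z) - (P * y + Q * z + R * x)"
    "(Q - R) * (y - z) = (P * x + Q * y + R * z) - (P * x + Q * z + R * y)"
    by (simp_all add: algebra_simps)
  then have "(P - Q) * (x - y) = 0" "(P - Q) * (x - z) = 0" "(P - Q) * (y - z) = 0"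
    "(Q - R) * (x - y) = 0" "(Q - R) * (x - z) = 0" "(Q - R) * (y - z) = 0"
    unfolding * by simp_all
  then show ?thesis
    using ne by auto
qed

text \<open>One step of the induction on \<open>\<delta>\<close>, after the offset has been shown to
  be 0. The case \<open>\<delta> = 1\<close> is settled by centering, and \<open>large\<close> will
  follow from the periodicity of power moments.\<close>

locale moment_step = sparse_degree f h K \<delta>
  for f h :: "'p::prime_card mod_ring \<Rightarrow> 'p mod_ring" and K \<delta> +
  fixes a1 a2 a3 :: "'p mod_ring"
  assumes col: "collinear_on f h a1 a2 a3 0" and nz: "a1 \<noteq> 0" "a2 \<noteq> 0" "a3 \<noteq> 0"
    and ne: "\<not> (a1 = a2 \<and> a2 = a3)"
    and K: "even K" "a1 ^ K = a2 ^ K" "a2 ^ K = a3 ^ K"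
    and bounds: "K + 2 \<le> CARD('p)" "2 \<le> \<delta>" "\<delta> + 2 \<le> CARD('p)"
    and large: "CARD('p) \<le> K + \<delta> \<Longrightarrow> minor f h 0 (K + \<delta>) = 0"
begin

abbreviation "u \<equiv> minor f h 0 (K + \<delta>)"
abbreviation "v \<equiv> minor f h \<delta> K"

lemma K_ge: "2 \<le> K"
  using K(1) pos(1) by presburger

lemma odd_card: "odd CARD('p)"
  using prime_card[where 'a = 'p] bounds by (intro prime_odd_nat) auto

lemma two_neq_0: "(2 :: 'p mod_ring) \<noteq> 0"
  using of_nat_mod_ring_neq_0[of 2, where 'p = 'p] bounds K_ge by simp

lemma interior:
  assumes "(x, y, z) \<in> orderings a1 a2 a3" "0 < s" "0 < t" "s + t = K + \<delta>" "s \<noteq> K"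
  shows "u * ((-1) ^ \<delta> * x ^ \<delta> - y ^ \<delta>)
    + v * (of_nat (s choose K) * y ^ \<delta> - of_nat (s choose \<delta>) * z ^ \<delta>
      + (-1) ^ \<delta> * of_nat (t choose \<delta>) * z ^ \<delta>
      - (if t = K then 0 else (-1) ^ \<delta> * of_nat (t choose K) * x ^ \<delta>)) = 0"
proof -
  have "x \<noteq> 0" "y \<noteq> 0" "z \<noteq> 0" "x ^ K = y ^ K" "z ^ K = y ^ K"
    using assms(1) nz K unfolding orderings_def by auto
  then show ?thesis
    using interior_identity[OF collinear_on_orderings[OF col assms(1)]] K(1) assms(2-) by blast
qed

lemma boundary:
  assumes "(x, y, z) \<in> orderings a1 a2 a3"
  shows "(u - of_nat (K + \<delta> choose \<delta>) * v) * (z ^ \<delta> - x ^ \<delta>) = 0"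
proof -
  have "x \<noteq> 0" "y \<noteq> 0" "z \<noteq> 0" "x ^ K = y ^ K" "z ^ K = y ^ K"
    using assms(1) nz K unfolding orderings_def by auto
  then show ?thesis
    using boundary_identity[OF collinear_on_orderings[OF col assms(1)]] K(1) by blast
qed

text \<open>Now \<open>u = 0\<close>. Taking \<open>s\<close> near \<open>CARD('p)\<close> leaves
  \<open>t\<close> below \<open>K\<close> and \<open>\<delta>\<close>, so the binomials in
  \<open>t\<close> vanish and those in \<open>s\<close> are explicit. The choice
  \<open>s = CARD('p) - 1\<close> forces \<open>\<delta>\<close> to be even, and
  \<open>s = CARD('p) - 2\<close> then forces \<open>K = \<delta>\<close>.\<close>

lemma step_large:
  assumes N: "CARD('p) \<le> K + \<delta>"
  shows "v = 0"
proof (rule ccontr)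
  assume v: "v \<noteq> 0"
  let ?p = "CARD('p)"
  let ?\<epsilon> = "(-1) ^ \<delta> :: 'p mod_ring"
  have u: "u = 0"
    using large N by simp
  have eps: "y ^ \<delta> = ?\<epsilon> * z ^ \<delta>" if "(x, y, z) \<in> orderings a1 a2 a3" for x y z
  proof -
    define t where "t = K + \<delta> - (?p - 1)"
    have t: "0 < t" "t < K" "t < \<delta>" "?p - 1 + t = K + \<delta>" "0 < ?p - 1" "?p - 1 \<noteq> K"
      using N bounds unfolding t_def by auto
    show ?thesis
      using interior[OF that t(5,1,4,6)] u v t bounds K(1)
        of_nat_choose_CARD_minus_1[of K, where 'p = 'p] of_nat_choose_CARD_minus_1[of \<delta>, where 'p = 'p]
      by (simp add: binomial_eq_0)
  qed
  have e: "a1 ^ \<delta> = ?\<epsilon> * a2 ^ \<delta>" "a2 ^ \<delta> = ?\<epsilon> * a3 ^ \<delta>" "a1 ^ \<delta> = ?\<epsilon> * a3 ^ \<delta>"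
    using eps[of a3 a1 a2] eps[of a1 a2 a3] eps[of a2 a1 a3]
    by (simp_all add: orderings_def)
  \<comment> \<open>For odd \<open>\<delta>\<close> the three powers would be pairwise negatives of
    each other.\<close>
  have even: "even \<delta>"
  proof (rule ccontr)
    assume "odd \<delta>"
    then have "a1 ^ \<delta> = - (a2 ^ \<delta>)" "a2 ^ \<delta> = - (a3 ^ \<delta>)" "a1 ^ \<delta> = - (a3 ^ \<delta>)"
      using e by auto
    then have "2 * a3 ^ \<delta> = 0"
      by simp
    then show False
      using two_neq_0 nz by simp
  qed
  have odd_p2: "odd (?p - 2)"
    using odd_card bounds by simp
  define t where "t = K + \<delta> - (?p - 2)"
  \<comment> \<open>By parity: \<open>?p - 2\<close> is odd while \<open>K\<close> and
    \<open>\<delta>\<close> are even.\<close>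
  have ne: "?p - 2 \<noteq> K" "?p - 2 \<noteq> \<delta>"
    using odd_p2 K(1) even by metis+
  have t: "0 < t" "t < K" "t < \<delta>" "?p - 2 + t = K + \<delta>" "0 < ?p - 2"
    using N bounds ne K_ge unfolding t_def by auto
  have "of_nat (Suc K) * a2 ^ \<delta> - of_nat (Suc \<delta>) * a3 ^ \<delta> = 0"
    using interior[of a1 a2 a3, OF _ t(5,1,4) ne(1)] u v t bounds K(1) even
      of_nat_choose_CARD_minus_2[of K, where 'p = 'p] of_nat_choose_CARD_minus_2[of \<delta>, where 'p = 'p]
    by (simp add: binomial_eq_0 orderings_def)
  then have "(of_nat (Suc K) - of_nat (Suc \<delta>)) * a3 ^ \<delta> = 0"
    using e even by (simp add: left_diff_distrib)
  then have "of_nat (Suc K) = (of_nat (Suc \<delta>) :: 'p mod_ring)"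
    using nz by (metis mult_eq_0_iff power_not_zero right_minus_eq)
  then have "Suc K = Suc \<delta>"
    using bounds by (intro of_nat_mod_ring_inj[where 'p = 'p]) auto
  then show False
    using pos by simp
qed

lemma choose_split: "K + \<delta> choose \<delta> = (K + \<delta> - 1 choose \<delta>) + (K + \<delta> - 1 choose K)"
proof -
  have "K + \<delta> - 1 choose (\<delta> - 1) = (K + \<delta> - 1 choose K)"
    using binomial_symmetric[of K "K + \<delta> - 1"] pos by (simp add: diff_diff_add)
  then show ?thesis
    using choose_reduce_nat[of "K + \<delta>" \<delta>] pos by simp
qed

lemma choose_absorb:
  "(K + \<delta>) * (K + \<delta> - 1 choose \<delta>) = K * (K + \<delta> choose \<delta>)"
  "(K + \<delta>) * (K + \<delta> - 1 choose K) = \<delta> * (K + \<delta> choose \<delta>)"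
  using binomial_absorb_comp[of "K + \<delta>" \<delta>] binomial_absorb_comp[of "K + \<delta>" K]
    binomial_symmetric[of K "K + \<delta>"] by simp_all

text \<open>The boundary identity gives \<open>u = ?C * v\<close>. The interior identity for
  \<open>s = 1\<close> is a linear form in the \<open>\<delta>\<close>-th powers that vanishes under
  all permutations, so its three coefficients agree; for either parity of \<open>\<delta>\<close>
  this is impossible when \<open>v\<close> is nonzero.\<close>

lemma step_unequal:
  assumes N: "K + \<delta> < CARD('p)" and unequal: "\<not> (a1 ^ \<delta> = a2 ^ \<delta> \<and> a2 ^ \<delta> = a3 ^ \<delta>)"
  shows "v = 0"
proof (rule ccontr)
  assume v: "v \<noteq> 0"
  let ?\<epsilon> = "(-1) ^ \<delta> :: 'p mod_ring"
  let ?C = "of_nat (K + \<delta> choose \<delta>) :: 'p mod_ring"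
  let ?D = "of_nat (K + \<delta> - 1 choose \<delta>) :: 'p mod_ring"
  let ?E = "of_nat (K + \<delta> - 1 choose K) :: 'p mod_ring"
  have C: "?C = ?D + ?E"
    unfolding choose_split by simp
  have uC: "u = ?C * v"
    using boundary[of a1 a3 a2] boundary[of a2 a1 a3] unequal by (auto simp: orderings_def)
  have lin: "?\<epsilon> * u - ?\<epsilon> * v * ?E = - u \<and> - u = ?\<epsilon> * v * ?D"
  proof (rule symmetric_linear_form[OF _ unequal])
    fix x' y' z'
    assume "(x', y', z') \<in> orderings (a1 ^ \<delta>) (a2 ^ \<delta>) (a3 ^ \<delta>)"
    then obtain x y z where xyz: "(x, y, z) \<in> orderings a1 a2 a3" "x' = x ^ \<delta>" "y' = y ^ \<delta>" "z' = z ^ \<delta>"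
      unfolding orderings_def by auto
    have t: "0 < K + \<delta> - 1" "1 + (K + \<delta> - 1) = K + \<delta>" "1 \<noteq> K" "K + \<delta> - 1 \<noteq> K" "(0::nat) < 1"
      using K_ge bounds by auto
    show "(?\<epsilon> * u - ?\<epsilon> * v * ?E) * x' + - u * y' + ?\<epsilon> * v * ?D * z' = 0"
      using interior[OF xyz(1) t(5,1,2,3)] t(4) K_ge bounds
      unfolding xyz by (simp add: binomial_eq_0 algebra_simps)
  qed
  show False
  proof (cases "even \<delta>")
    case True
    then have "- u = v * ?D"
      using lin by simp
    moreover have "v * (2 * ?D + ?E) = u + v * ?D"
      unfolding uC C by (simp add: algebra_simps)
    ultimately have "v * (2 * ?D + ?E) = 0"
      by (metis add.right_inverse)
    then have "2 * ?D + ?E = 0"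
      using v by simp
    \<comment> \<open>The factor \<open>K + \<delta>\<close> allows absorption, which expresses both
      binomials through \<open>?C\<close>.\<close>
    then have "of_nat (K + \<delta>) * (2 * ?D + ?E) = (0 :: 'p mod_ring)"
      by simp
    moreover have "of_nat (K + \<delta>) * (2 * ?D + ?E) = of_nat (2 * K + \<delta>) * ?C"
    proof -
      have "(K + \<delta>) * (2 * (K + \<delta> - 1 choose \<delta>) + (K + \<delta> - 1 choose K)) =
          (2 * K + \<delta>) * (K + \<delta> choose \<delta>)"
        using choose_absorb by (simp add: algebra_simps)
      from arg_cong[OF this, of of_nat] show ?thesis
        by (simp only: of_nat_mult of_nat_add of_nat_numeral)
    qed
    moreover have "?C \<noteq> 0"
      using N by (intro of_nat_choose_neq_0) auto
    ultimately have "of_nat (2 * K + \<delta>) = (0 :: 'p mod_ring)"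
      by (metis mult_eq_0_iff)
    then have "CARD('p) dvd 2 * K + \<delta>"
      by (simp only: of_nat_mod_ring_eq_0_iff)
    then obtain m where m: "2 * K + \<delta> = CARD('p) * m"
      by (elim dvdE)
    have "0 < m"
      using m pos by (cases m) auto
    moreover have "m < 2"
    proof (rule ccontr)
      assume "\<not> m < 2"
      then have "CARD('p) * 2 \<le> CARD('p) * m"
        by (intro mult_le_mono2) simp
      then show False
        using N bounds unfolding m[symmetric] by linarith
    qed
    ultimately have "m = 1"
      by simp
    \<comment> \<open>Here the left side is even and the prime is odd.\<close>
    then have "2 * K + \<delta> = CARD('p)"
      using m by simp
    then show False
      using odd_card True by (metis dvd_add dvd_triv_left)
  next
    case False
    then have "v * ?E = 0"
      using lin unfolding uC C by (simp add: algebra_simps)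
    moreover have "?E \<noteq> 0"
      using N bounds by (intro of_nat_choose_neq_0) auto
    ultimately show False
      using v by simp
  qed
qed

text \<open>The terms in \<open>u\<close> cancel, and \<open>s = 1\<close> gives
  \<open>?D = ?E\<close>. By absorption \<open>K\<close> and \<open>\<delta>\<close> agree modulo
  the prime, hence are equal.\<close>

lemma step_equal_even:
  assumes N: "K + \<delta> < CARD('p)" and equal: "a1 ^ \<delta> = a2 ^ \<delta>" "a2 ^ \<delta> = a3 ^ \<delta>" and "even \<delta>"
  shows "v = 0"
proof (rule ccontr)
  assume v: "v \<noteq> 0"
  let ?C = "of_nat (K + \<delta> choose \<delta>) :: 'p mod_ring"
  let ?D = "of_nat (K + \<delta> - 1 choose \<delta>) :: 'p mod_ring"
  let ?E = "of_nat (K + \<delta> - 1 choose K) :: 'p mod_ring"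
  have t: "0 < K + \<delta> - 1" "1 + (K + \<delta> - 1) = K + \<delta>" "1 \<noteq> K" "K + \<delta> - 1 \<noteq> K" "(0::nat) < 1"
    using K_ge bounds by auto
  have "v * (?D - ?E) * a3 ^ \<delta> = 0"
    using interior[of a1 a2 a3, OF _ t(5,1,2,3)] t(4) K_ge bounds equal \<open>even \<delta>\<close>
    by (auto simp: binomial_eq_0 orderings_def algebra_simps)
  then have "?D = ?E"
    using v nz by auto
  then have "of_nat ((K + \<delta>) * (K + \<delta> - 1 choose \<delta>)) = (of_nat ((K + \<delta>) * (K + \<delta> - 1 choose K)) :: 'p mod_ring)"
    by (simp only: of_nat_mult)
  then have "of_nat K * ?C = of_nat \<delta> * ?C"
    unfolding choose_absorb of_nat_mult .
  moreover have "?C \<noteq> 0"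
    using N by (intro of_nat_choose_neq_0) auto
  ultimately have "of_nat K = (of_nat \<delta> :: 'p mod_ring)"
    by simp
  then have "K = \<delta>"
    using bounds by (intro of_nat_mod_ring_inj[where 'p = 'p]) auto
  then show False
    using pos by simp
qed

text \<open>The exponents \<open>K\<close> and \<open>\<delta>\<close> are coprime in these cases.
  They are the small exceptions in the odd step and would make all coefficients equal.\<close>

lemma eq_if_powers_eq:
  assumes "x ^ K = y ^ K" "x ^ \<delta> = y ^ \<delta>" "odd \<delta>" "y \<noteq> (0 :: 'p mod_ring)"
    and "K = 2 \<or> K = 4 \<and> \<delta> = 3"
  shows "x = y"
  using assms(5)
proof (elim disjE conjE)
  assume "K = 2"
  obtain m where m: "\<delta> = 2 * m + 1"
    using \<open>odd \<delta>\<close> by (elim oddE)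
  have "x ^ \<delta> = (x ^ K) ^ m * x" "y ^ \<delta> = (y ^ K) ^ m * y"
    by (simp_all only: m \<open>K = 2\<close> power_add power_one_right flip: power_mult)
  then have "(y ^ K) ^ m * x = (y ^ K) ^ m * y"
    using assms(1,2) by auto
  then show ?thesis
    using assms(4) by simp
next
  assume "K = 4" "\<delta> = 3"
  then have "y ^ 3 * x = x ^ 3 * x" "x ^ 3 * x = y ^ 3 * y"
    using assms(1,2) by (simp_all add: power3_eq_cube power4_eq_xxxx mult.assoc)
  then show ?thesis
    using assms(4) by simp
qed

text \<open>Each admissible \<open>s\<close> gives a relation between \<open>v\<close> and
  \<open>2 * u\<close>. Comparing two values of \<open>s\<close> eliminates \<open>u\<close> and
  leaves an equation between binomial coefficients.\<close>

lemma step_equal_odd: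
  assumes N: "K + \<delta> < CARD('p)" and equal: "a1 ^ \<delta> = a2 ^ \<delta>" "a2 ^ \<delta> = a3 ^ \<delta>" and "odd \<delta>"
  shows "v = 0"
proof (rule ccontr)
  assume v: "v \<noteq> 0"
  have small: "\<not> (K = 2 \<or> K = 4 \<and> \<delta> = 3)"
    using eq_if_powers_eq[of a1 a2] eq_if_powers_eq[of a2 a3] K equal nz ne \<open>odd \<delta>\<close> by auto
  have K4: "4 \<le> K"
    using small K_ge K(1) by presburger
  have d3: "3 \<le> \<delta>"
    using bounds \<open>odd \<delta>\<close> by presburger
  have triv: "(a1, a2, a3) \<in> orderings a1 a2 a3"
    by (simp add: orderings_def)
  define w where "w = K + \<delta>"
  have low: "v * (of_nat (w - s choose K) - of_nat (w - s choose \<delta>)) = 2 * u"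
    if s: "0 < s" "s < K" "s < \<delta>" for s
  proof -
    have t: "0 < w - s" "s + (w - s) = K + \<delta>" "s \<noteq> K" "w - s \<noteq> K"
      using s unfolding w_def by auto
    have "(v * (of_nat (w - s choose K) - of_nat (w - s choose \<delta>)) - 2 * u) * a3 ^ \<delta> = 0"
      using interior[OF triv s(1) t(1-3)] t(4) s equal \<open>odd \<delta>\<close>
      by (simp add: binomial_eq_0 algebra_simps)
    then show ?thesis
      using nz by simp
  qed
  show False
  proof (cases "\<delta> = 3")
    case True
    have "v * (of_nat (K + 1 choose K) - of_nat (K + 1 choose 3)) = 2 * u"
      using low[of 2] K4 True by (simp add: w_def)
    \<comment> \<open>For \<open>\<delta> = 3\<close> the value \<open>s = 3\<close> is not covered
      by \<open>low\<close>: now \<open>t = K\<close>, the conditional term is absent, and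
      \<open>3 choose 3\<close> contributes the \<open>- 1\<close>.\<close>
    moreover have "v * (- 1 - of_nat (K choose 3)) = 2 * u"
    proof -
      have "(v * (- 1 - of_nat (K choose 3)) - 2 * u) * a3 ^ \<delta> = 0"
        using interior[OF triv, of 3 K] True K4 equal by (simp add: binomial_eq_0 algebra_simps)
      then show ?thesis
        using nz by simp
    qed
    ultimately have "of_nat (K + 1 choose K) - of_nat (K + 1 choose 3) = (- 1 - of_nat (K choose 3) :: 'p mod_ring)"
      using v by (metis mult_left_cancel)
    moreover have "K + 1 choose 3 = (K choose 2) + (K choose 3)" "K + 1 choose K = K + 1"
      using choose_reduce_nat[of "K + 1" 3] by simp_all
    ultimately have "of_nat (K choose 2) = (of_nat (K + 2) :: 'p mod_ring)"
      by (simp add: algebra_simps)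
    then have "of_nat (2 * (K choose 2)) = (of_nat (2 * (K + 2)) :: 'p mod_ring)"
      by (simp only: of_nat_mult)
    moreover have "2 * (K choose 2) = K * (K - 1)"
      using times_binomial_minus1_eq[of 2 K] by simp
    \<comment> \<open>The difference factors as \<open>(K - 4) * (K + 1)\<close>;
      \<open>K = 4\<close> is one of the excluded exceptions, and \<open>K + 1\<close> is below the
      prime.\<close>
    moreover have "K * (K - 1) = 2 * (K + 2) + (K - 4) * (K + 1)"
      using K4 by (auto simp: le_iff_add algebra_simps)
    ultimately have "of_nat (2 * (K + 2) + (K - 4) * (K + 1)) = (of_nat (2 * (K + 2)) :: 'p mod_ring)"
      by metis
    then have "of_nat ((K - 4) * (K + 1)) = (0 :: 'p mod_ring)"
      by (simp only: of_nat_add[of "2 * (K + 2)"] add_cancel_left_right)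
    then have "of_nat (K - 4) = (0 :: 'p mod_ring) \<or> of_nat (K + 1) = (0 :: 'p mod_ring)"
      by (simp only: of_nat_mult mult_eq_0_iff)
    moreover have "K - 4 > 0"
      using K4 small True by auto
    ultimately show False
      using of_nat_mod_ring_neq_0[of "K - 4", where 'p = 'p] of_nat_mod_ring_neq_0[of "K + 1", where 'p = 'p]
        bounds by auto
  next
    case False
    then have d5: "5 \<le> \<delta>"
      using d3 \<open>odd \<delta>\<close> by presburger
    let ?B = "w - 2 choose (K - 1)"
    have w: "w - 2 = Suc (w - 3)"
      using K4 by (simp add: w_def)
    have "v * (of_nat (w - 2 choose K) - of_nat (w - 2 choose \<delta>)) =
        v * (of_nat (w - 3 choose K) - of_nat (w - 3 choose \<delta>))"
      using low[of 2] low[of 3] K4 d5 by simp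
    then have "of_nat (w - 2 choose K) - of_nat (w - 2 choose \<delta>) =
        (of_nat (w - 3 choose K) - of_nat (w - 3 choose \<delta>) :: 'p mod_ring)"
      using v by (metis mult_left_cancel)
    moreover have "w - 2 choose K = (w - 3 choose (K - 1)) + (w - 3 choose K)"
      "w - 2 choose \<delta> = (w - 3 choose (\<delta> - 1)) + (w - 3 choose \<delta>)"
      unfolding w using K4 d5 by (simp_all add: choose_reduce_nat[of "Suc _"])
    ultimately have eq: "of_nat (w - 3 choose (K - 1)) = (of_nat (w - 3 choose (\<delta> - 1)) :: 'p mod_ring)"
      by (simp add: algebra_simps)
    have sym: "w - 2 choose (\<delta> - 1) = ?B"
      using binomial_symmetric[of "K - 1" "w - 2"] K4 d5 by (simp add: w_def)
    have "w - 2 - (K - 1) = \<delta> - 1" "w - 2 - (\<delta> - 1) = K - 1" "w - 2 - 1 = w - 3"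
      using K4 d5 by (simp_all add: w_def)
    \<comment> \<open>Absorption relates both entries of row \<open>w - 3\<close> to the same entry
      \<open>?B\<close> of row \<open>w - 2\<close>.\<close>
    then have "(\<delta> - 1) * ?B = (w - 2) * (w - 3 choose (K - 1))"
      "(K - 1) * ?B = (w - 2) * (w - 3 choose (\<delta> - 1))"
      using binomial_absorb_comp[of "w - 2" "K - 1"] binomial_absorb_comp[of "w - 2" "\<delta> - 1"] sym
      by simp_all
    then have "of_nat ((\<delta> - 1) * ?B) = (of_nat ((K - 1) * ?B) :: 'p mod_ring)"
      using eq by (simp only: of_nat_mult)
    moreover have "of_nat ?B \<noteq> (0 :: 'p mod_ring)"
      using N bounds by (intro of_nat_choose_neq_0) (auto simp: w_def)
    ultimately have "of_nat (\<delta> - 1) = (of_nat (K - 1) :: 'p mod_ring)"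
      by (metis of_nat_mult mult_right_cancel)
    then have "\<delta> - 1 = K - 1"
      using bounds by (intro of_nat_mod_ring_inj[where 'p = 'p]) auto
    then show False
      using pos by simp
  qed
qed

lemma step: "v = 0"
  using step_large step_unequal step_equal_even step_equal_odd by (meson not_le)

end

section \<open>Moments over a prime field\<close>

lemma power_CARD_minus_1:
  fixes x :: "'p::prime_card mod_ring"
  assumes "x \<noteq> 0"
  shows "x ^ (CARD('p) - 1) = 1"
proof -
  have "x ^ (CARD('p) - 1) * x = 1 * x"
    using finite_field_power_card_eq_same[of x]
    by (simp flip: power_Suc2)
  then show ?thesis
    using assms by simp
qed

text \<open>Uses \<open>x ^ CARD('p) = x\<close>. The new exponent stays positive, so the reduction
  also holds at \<open>x = 0\<close>.\<close>

lemma moment_periodic: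
  fixes f :: "'p::prime_card mod_ring \<Rightarrow> 'p mod_ring"
  assumes "CARD('p) \<le> n"
  shows "moment f n = moment f (n + 1 - CARD('p))"
proof -
  have "x ^ n = x ^ (n + 1 - CARD('p))" for x :: "'p mod_ring"
  proof -
    have "x ^ n = x ^ CARD('p) * x ^ (n - CARD('p))"
      using assms by (simp flip: power_add)
    also have "\<dots> = x ^ (n + 1 - CARD('p))"
      using finite_field_power_card_eq_same[of x] assms by (simp add: Suc_diff_le)
    finally show ?thesis .
  qed
  then show ?thesis
    by (simp add: moment_def)
qed

text \<open>The indicator function of \<open>c\<close> is \<open>1 - (x - c) ^ (CARD('p) - 1)\<close>, and the hypothesis kills
  all but the extreme terms of the binomial expansion.\<close>

lemma eq_of_middle_moments_eq_0:
  fixes g :: "'p::prime_card mod_ring \<Rightarrow> 'p mod_ring"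
  assumes mid: "\<And>i. 0 < i \<Longrightarrow> i + 2 \<le> CARD('p) \<Longrightarrow> moment g i = 0" and p: "2 < CARD('p)"
  shows "g c = (if c = 0 then moment g 0 else 0) - moment g (CARD('p) - 1)"
proof -
  let ?n = "CARD('p) - 1"
  have ind: "1 - (x + - c) ^ ?n = (if x = c then 1 else 0)" for x
    using power_CARD_minus_1[of "x - c"] p by simp
  have "g c = (\<Sum>x\<in>UNIV. g x * (1 - (x + - c) ^ ?n))"
    unfolding ind by (simp add: if_distrib[of "(*) _"] cong: if_cong)
  also have "\<dots> = moment g 0 - (\<Sum>x\<in>UNIV. g x * (x + - c) ^ ?n)"
    by (simp add: moment_def algebra_simps sum_subtractf)
  also have "(\<Sum>x\<in>UNIV. g x * (x + - c) ^ ?n) =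
      (\<Sum>x\<in>UNIV. \<Sum>j\<le>?n. of_nat (?n choose j) * (- c) ^ (?n - j) * (g x * x ^ j))"
    unfolding binomial_ring sum_distrib_left by (simp add: ac_simps)
  also have "\<dots> = (\<Sum>j\<le>?n. of_nat (?n choose j) * (- c) ^ (?n - j) * moment g j)"
    unfolding moment_def sum_distrib_left by (rule sum.swap)
  also have "\<dots> = (\<Sum>j\<in>{0, ?n}. of_nat (?n choose j) * (- c) ^ (?n - j) * moment g j)"
    by (rule sum.mono_neutral_right) (auto simp: mid)
  also have "\<dots> = (- c) ^ ?n * moment g 0 + moment g ?n"
    using p by simp
  finally show ?thesis
    using power_CARD_minus_1[of "- c"] p by (auto simp: zero_power)
qed

text \<open>If \<open>K\<close> were odd, passing around the cycle of three ratios would give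
  \<open>a1 ^ K = - (a1 ^ K)\<close>.\<close>

lemma ratio_powers:
  assumes "(- a1 / a2) ^ K = 1" "(- a2 / a3) ^ K = 1" "(- a3 / a1) ^ K = 1"
    and nz: "a1 \<noteq> 0" "a2 \<noteq> 0" "a3 \<noteq> (0 :: 'a::field)" and two: "(2 :: 'a) \<noteq> 0"
  shows "even K \<and> a1 ^ K = a2 ^ K \<and> a2 ^ K = a3 ^ K"
proof -
  have *: "(- a1) ^ K = a2 ^ K" "(- a2) ^ K = a3 ^ K" "(- a3) ^ K = a1 ^ K"
    using assms(1-3) nz by (simp_all only: power_divide) (simp_all add: field_simps)
  have "even K"
  proof (rule ccontr)
    assume "odd K"
    then have "- (a1 ^ K) = a2 ^ K" "- (a2 ^ K) = a3 ^ K" "- (a3 ^ K) = a1 ^ K"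
      using * by simp_all
    then have "2 * a1 ^ K = 0"
      by (metis add.right_inverse minus_minus mult_2)
    then show False
      using two nz by simp
  qed
  then show ?thesis
    using * by simp
qed

lemma centered_moments:
  fixes f h :: "'p::prime_card mod_ring \<Rightarrow> 'p mod_ring"
  assumes col: "collinear_on f h a1 a2 a3 b" and nz: "a1 \<noteq> 0" "a2 \<noteq> 0" "a3 \<noteq> 0"
    and ne: "\<not> (a1 = a2 \<and> a2 = a3)" and p: "2 < CARD('p)"
    and m0: "moment f 0 \<noteq> 0 \<or> moment h 0 \<noteq> 0"
    and m1: "moment f 1 = 0" "moment h 1 = 0"
    and ex: "\<exists>i. i + 2 \<le> CARD('p) \<and> minor f h 0 i \<noteq> 0"
  shows "b = 0 \<and> (\<exists>K. minor f h 0 K \<noteq> 0 \<and>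
    (\<forall>i. 0 < i \<and> i + 2 \<le> CARD('p) \<longrightarrow> minor f h i K = 0))"
proof -
  define K where "K = (LEAST i. minor f h 0 i \<noteq> 0)"
  have T: "minor f h 0 K \<noteq> 0"
    unfolding K_def using ex LeastI_ex[of "\<lambda>i. minor f h 0 i \<noteq> 0"] by blast
  have low: "minor f h 0 i = 0" if "i < K" for i
    using not_less_Least[of i] that unfolding K_def by auto
  have Kb: "K + 2 \<le> CARD('p)"
    using ex Least_le[of "\<lambda>i. minor f h 0 i \<noteq> 0"] unfolding K_def by fastforce
  have one: "minor f h 1 i = 0" "minor f h i 1 = 0" for i
    using m1 by (simp_all add: minor_def)
  have K1: "1 < K"
    using T one[of 0] by (metis less_one linorder_neqE_nat minor_same)
  have low2: "minor f h i j = 0" if "i < K" "j < K" for i j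
    using minor_below[OF m0] low that by blast
  have two: "(2 :: 'p mod_ring) \<noteq> 0"
    using of_nat_mod_ring_neq_0[of 2, where 'p = 'p] p by simp
  note perm = collinear_on_orderings[OF col]
  have K: "even K \<and> a1 ^ K = a2 ^ K \<and> a2 ^ K = a3 ^ K"
  proof (rule ratio_powers[OF _ _ _ nz two])
    show "(- a1 / a2) ^ K = 1"
      by (rule ratio_power_eq_1[OF perm, of a1 a2 a3]) (use nz low2 K1 T in \<open>auto simp: orderings_def\<close>)
    show "(- a2 / a3) ^ K = 1"
      by (rule ratio_power_eq_1[OF perm, of a2 a3 a1]) (use nz low2 K1 T in \<open>auto simp: orderings_def\<close>)
    show "(- a3 / a1) ^ K = 1"
      by (rule ratio_power_eq_1[OF perm, of a3 a1 a2]) (use nz low2 K1 T in \<open>auto simp: orderings_def\<close>)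
  qed
  have off: "(x + y) * minor f h 0 (Suc K) = of_nat (Suc K) * b * minor f h 0 K"
    if "(x, y, z) \<in> orderings a1 a2 a3" for x y z
    by (rule offset_eq[OF perm[OF that]]) (use that nz low2 K1 T one in \<open>auto simp: orderings_def\<close>)
  \<comment> \<open>The right-hand side of \<open>off\<close> does not depend on the chosen pair;
    were this minor nonzero, all pair sums, and hence all coefficients, would agree.\<close>
  have "minor f h 0 (Suc K) = 0"
  proof (rule ccontr)
    assume U: "minor f h 0 (Suc K) \<noteq> 0"
    have "(a1 + a2) * minor f h 0 (Suc K) = (a1 + a3) * minor f h 0 (Suc K)"
      "(a1 + a2) * minor f h 0 (Suc K) = (a2 + a3) * minor f h 0 (Suc K)"
      using off[of a1 a2 a3] off[of a1 a3 a2] off[of a2 a3 a1] by (simp_all add: orderings_def)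
    then have "a1 + a2 = a1 + a3" "a1 + a2 = a2 + a3"
      using U by (metis mult_right_cancel)+
    then show False
      using ne by (auto simp: add.commute)
  qed
  moreover have "of_nat (Suc K) \<noteq> (0 :: 'p mod_ring)"
    using Kb by (intro of_nat_mod_ring_neq_0) auto
  ultimately have b: "b = 0"
    using off[of a1 a2 a3] T by (auto simp: orderings_def simp del: of_nat_Suc)
  have "minor f h i K = 0" if "0 < i" "i + 2 \<le> CARD('p)" for i
    using that
  proof (induction i rule: less_induct)
    case (less i)
    consider "i = K" | "i = 1" | "i \<noteq> K" "2 \<le> i"
      using less.prems by linarith
    then show ?case
    proof cases
      case 3
      interpret moment_step f h K i a1 a2 a3
      proof
        \<comment> \<open>Periodicity moves the index \<open>K + i\<close> to
          \<open>K + i + 1 - CARD('p)\<close>, which is below \<open>K\<close>.\<close>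
        show "minor f h 0 (K + i) = 0" if "CARD('p) \<le> K + i"
          using low[of "K + i + 1 - CARD('p)"] less.prems that moment_periodic[OF that]
          by (auto simp: minor_def)
      qed (use col b nz ne K T low Kb K1 3 less in auto)
      show ?thesis
        by (rule step)
    qed (use one in auto)
  qed
  then show ?thesis
    using b T by blast
qed

section \<open>Rainbow-free colorings\<close>

text \<open>The choice of \<open>i\<close>, \<open>j\<close>, \<open>k\<close> is absorbed into the
  order of the values, since \<open>S\<close> is the image of \<open>{i, j, k}\<close> under
  \<open>s\<close>.\<close>

lemma rainbow_free_iff:
  "rainbow_free a b A B C \<longleftrightarrow>
    (\<forall>x y z. a 1 * x + a 2 * y + a 3 * z = b \<longrightarrow> \<not> rainbow A B C {x, y, z})"
proof
  assume free: "rainbow_free a b A B C"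
  show "\<forall>x y z. a 1 * x + a 2 * y + a 3 * z = b \<longrightarrow> \<not> rainbow A B C {x, y, z}"
  proof (intro allI impI)
    fix x y z
    assume eq: "a 1 * x + a 2 * y + a 3 * z = b"
    define s :: "nat \<Rightarrow> 'a mod_ring" where "s i = (if i = 1 then x else if i = 2 then y else z)" for i
    have "{x, y, z} = {s 1, s 2, s 3} \<and> (\<exists>i j k. {i, j, k} = {1, 2, 3} \<and> a 1 * s i + a 2 * s j + a 3 * s k = b)"
      using eq by (intro conjI exI[of _ 1] exI[of _ 2] exI[of _ 3]) (auto simp: s_def)
    then have "is_solution a b {x, y, z}"
      unfolding is_solution_def by blast
    then show "\<not> rainbow A B C {x, y, z}"
      using free unfolding rainbow_free_def by blast
  qed
next
  assume none: "\<forall>x y z. a 1 * x + a 2 * y + a 3 * z = b \<longrightarrow> \<not> rainbow A B C {x, y, z}"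
  show "rainbow_free a b A B C"
    unfolding rainbow_free_def
  proof clarify
    fix S
    assume "is_solution a b S" and rain: "rainbow A B C S"
    then obtain s :: "nat \<Rightarrow> 'a mod_ring" and i j k where s: "S = {s 1, s 2, s 3}" "{i, j, k} = {1, 2, 3}"
      "a 1 * s i + a 2 * s j + a 3 * s k = b"
      unfolding is_solution_def by blast
    have "S = s ` {i, j, k}"
      unfolding s(1,2) by simp
    then show False
      using none s(3) rain by simp
  qed
qed

text \<open>The three colors correspond to the points \<open>(1, 0)\<close>, \<open>(0, 1)\<close>,
  \<open>(0, 0)\<close>. A triple that is not rainbow repeats one of them and so is collinear. The
  shift by \<open>c\<close> is kept for centering.\<close>

lemma rainbow_free_collinear_on:
  assumes free: "rainbow_free a b A B C" and part: "three_coloring A B C"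
  shows "collinear_on (\<lambda>x. of_bool (x + c \<in> A)) (\<lambda>x. of_bool (x + c \<in> B)) (a 1) (a 2) (a 3)
    (b - c * (a 1 + a 2 + a 3))"
  unfolding collinear_on_def
proof (intro allI impI)
  fix x y z
  assume "a 1 * x + a 2 * y + a 3 * z = b - c * (a 1 + a 2 + a 3)"
  then have "a 1 * (x + c) + a 2 * (y + c) + a 3 * (z + c) = b"
    by (simp add: algebra_simps)
  then have no: "\<not> rainbow A B C {x + c, y + c, z + c}"
    using free unfolding rainbow_free_iff by blast
  have rain: "\<not> (u \<in> A \<and> v \<in> B \<and> w \<in> C)" if "{x + c, y + c, z + c} = {u, v, w}" for u v w
    using no that unfolding rainbow_def by blast
  have six: "\<not> (x + c \<in> A \<and> y + c \<in> B \<and> z + c \<in> C)" "\<not> (x + c \<in> A \<and> z + c \<in> B \<and> y + c \<in> C)"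
    "\<not> (y + c \<in> A \<and> x + c \<in> B \<and> z + c \<in> C)" "\<not> (y + c \<in> A \<and> z + c \<in> B \<and> x + c \<in> C)"
    "\<not> (z + c \<in> A \<and> x + c \<in> B \<and> y + c \<in> C)" "\<not> (z + c \<in> A \<and> y + c \<in> B \<and> x + c \<in> C)"
    by (rule rain, blast)+
  have C: "w \<in> C \<longleftrightarrow> w \<notin> A \<and> w \<notin> B" and disj: "\<not> (w \<in> A \<and> w \<in> B)" for w
    using part unfolding three_coloring_def by blast+
  define f h :: "'a mod_ring \<Rightarrow> 'a mod_ring"
    where "f = (\<lambda>x. of_bool (x + c \<in> A))" and "h = (\<lambda>x. of_bool (x + c \<in> B))"
  have "f x = f y \<and> h x = h y \<or> f y = f z \<and> h y = h z \<or> f z = f x \<and> h z = h x"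
    using six disj[of "x + c"] disj[of "y + c"] disj[of "z + c"]
    unfolding C f_def h_def of_bool_eq_iff by argo
  then have "wedge f h x y + wedge f h y z + wedge f h z x = 0"
    by (elim disjE conjE) (simp_all add: wedge_def algebra_simps)
  then show "wedge (\<lambda>x. of_bool (x + c \<in> A)) (\<lambda>x. of_bool (x + c \<in> B)) x y +
      wedge (\<lambda>x. of_bool (x + c \<in> A)) (\<lambda>x. of_bool (x + c \<in> B)) y z +
      wedge (\<lambda>x. of_bool (x + c \<in> A)) (\<lambda>x. of_bool (x + c \<in> B)) z x = 0"
    unfolding f_def h_def .
qed

lemma moment_indicator:
  fixes c :: "'a::{field,finite}"
  shows "moment (\<lambda>x. of_bool (x + c \<in> S)) i = (\<Sum>y\<in>S. (y - c) ^ i)"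
proof -
  have "moment (\<lambda>x. of_bool (x + c \<in> S)) i = (\<Sum>y\<in>UNIV. of_bool (y \<in> S) * (y - c) ^ i)"
    unfolding moment_def
    by (rule sum.reindex_bij_witness[of _ "\<lambda>y. y - c" "\<lambda>x. x + c"]) auto
  also have "\<dots> = (\<Sum>y\<in>S. (y - c) ^ i)"
    by (simp add: of_bool_def if_distrib[of "\<lambda>t. t * _"] sum.If_cases flip: sum.inter_filter cong: if_cong)
  finally show ?thesis .
qed

lemma rainbow_free_singleton:
  fixes a :: "nat \<Rightarrow> 'p::prime_card mod_ring"
  assumes nz: "a 1 * a 2 * a 3 \<noteq> 0" and ne: "\<not> (a 1 = a 2 \<and> a 2 = a 3)"
    and part: "three_coloring A B C" and card: "card A \<le> card B" "card B \<le> card C"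
    and free: "rainbow_free a b A B C"
  shows "\<exists>s. A = {s} \<and> s * (a 1 + a 2 + a 3) = b"
proof -
  have parts: "A \<union> B \<union> C = UNIV" "A \<inter> B = {}" "A \<inter> C = {}" "B \<inter> C = {}" "A \<noteq> {}" "B \<noteq> {}" "C \<noteq> {}"
    using part unfolding three_coloring_def by auto
  have nz': "a 1 \<noteq> 0" "a 2 \<noteq> 0" "a 3 \<noteq> 0"
    using nz by auto
  have "card (A \<union> B \<union> C) = card (A \<union> B) + card C" "card (A \<union> B) = card A + card B"
    using parts by (intro card_Un_disjoint; auto)+
  then have sum_card: "card A + card B + card C = CARD('p)"
    unfolding parts(1) by simp
  have pos: "0 < card A" "0 < card B" "0 < card C"
    using parts by (simp_all add: card_gt_0_iff)
  have p: "2 < CARD('p)"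
    using sum_card pos by linarith
  have cardA: "of_nat (card A) \<noteq> (0 :: 'p mod_ring)"
    using pos sum_card by (intro of_nat_mod_ring_neq_0) auto
  \<comment> \<open>The mean of \<open>A\<close>: it makes the first moment of \<open>f\<close>
    vanish, and \<open>minor f h 0 1 = 0\<close> then does the same for \<open>h\<close>.\<close>
  define c where "c = \<Sum>A / of_nat (card A)"
  define f h :: "'p mod_ring \<Rightarrow> 'p mod_ring" where "f = (\<lambda>x. of_bool (x + c \<in> A))" and "h = (\<lambda>x. of_bool (x + c \<in> B))"
  have col: "collinear_on f h (a 1) (a 2) (a 3) (b - c * (a 1 + a 2 + a 3))"
    unfolding f_def h_def by (rule rainbow_free_collinear_on[OF free part])
  have f0: "moment f 0 = of_nat (card A)"
    by (simp add: f_def moment_indicator)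
  have f1: "moment f 1 = 0"
    using cardA by (simp add: f_def moment_indicator sum_subtractf c_def)
  have "minor f h 0 1 = 0"
    by (rule minor_0_1_eq_0[OF col nz' ne])
  then have h1: "moment h 1 = 0"
    using f0 f1 cardA by (simp add: minor_def)
  obtain yA yB yC where y: "yA \<in> A" "yB \<in> B" "yC \<in> C"
    using parts by blast
  have "\<exists>i. i + 2 \<le> CARD('p) \<and> minor f h 0 i \<noteq> 0"
  proof (rule ccontr)
    assume *: "\<nexists>i. i + 2 \<le> CARD('p) \<and> minor f h 0 i \<noteq> 0"
    \<comment> \<open>Otherwise this combination has zero moments up to index
      \<open>CARD('p) - 2\<close> and is constant, although its values on \<open>B\<close> and on
      \<open>C\<close> differ by \<open>moment f 0\<close>.\<close>
    define g where "g x = moment f 0 * h x - moment h 0 * f x" for x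
    have "moment g i = minor f h 0 i" for i
      unfolding g_def minor_def moment_def[of _ i]
      by (simp add: sum_subtractf sum_distrib_left algebra_simps)
    then have "moment g i = 0" if "i + 2 \<le> CARD('p)" for i
      using * that by auto
    then have "g x = g (yC - c)" for x
      using eq_of_middle_moments_eq_0[OF _ p, of g] p by simp
    then have "g (yB - c) = g (yC - c)" .
    moreover have "f (yB - c) = 0" "h (yB - c) = 1" "f (yC - c) = 0" "h (yC - c) = 0"
      using y parts by (auto simp: f_def h_def)
    ultimately have "moment f 0 = 0"
      by (simp add: g_def)
    then show False
      using f0 cardA by simp
  qed
  then obtain K where bc: "b - c * (a 1 + a 2 + a 3) = 0" and T: "minor f h 0 K \<noteq> 0"
    and mid: "\<And>i. 0 < i \<Longrightarrow> i + 2 \<le> CARD('p) \<Longrightarrow> minor f h i K = 0"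
    using centered_moments[OF col nz' ne p _ f1 h1] f0 cardA by metis
  \<comment> \<open>Its middle moments vanish but moment 0 does not, so it is constant away from 0
    and takes a different value at 0. Hence \<open>c\<close> shares its color with no other
    element.\<close>
  define g where "g x = moment h K * f x - moment f K * h x" for x
  have g: "moment g i = minor f h i K" for i
    unfolding g_def minor_def moment_def[of _ i]
    by (simp add: sum_subtractf sum_distrib_left sum_distrib_right algebra_simps)
  have gval: "g x = (if x = 0 then minor f h 0 K else 0) - minor f h (CARD('p) - 1) K" for x
    using eq_of_middle_moments_eq_0[OF _ p, of g x] mid unfolding g by blast
  have diff: "\<not> ((y \<in> A \<longleftrightarrow> c \<in> A) \<and> (y \<in> B \<longleftrightarrow> c \<in> B))" if "y \<noteq> c" for y
  proof
    assume "(y \<in> A \<longleftrightarrow> c \<in> A) \<and> (y \<in> B \<longleftrightarrow> c \<in> B)"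
    then have "f (y - c) = f 0" "h (y - c) = h 0"
      by (simp_all add: f_def h_def)
    then have "g (y - c) = g 0"
      by (simp only: g_def)
    then show False
      using that T by (simp add: gval[of "y - c"] gval[of 0])
  qed
  have C: "w \<in> C \<longleftrightarrow> w \<notin> A \<and> w \<notin> B" and disj: "\<not> (w \<in> A \<and> w \<in> B)" for w
    using parts(1-4) by blast+
  have same: "c \<in> A \<Longrightarrow> y \<in> A \<Longrightarrow> y = c" "c \<in> B \<Longrightarrow> y \<in> B \<Longrightarrow> y = c" "c \<in> C \<Longrightarrow> y \<in> C \<Longrightarrow> y = c" for y
    using diff[of y] C[of y] C[of c] disj[of y] disj[of c] by argo+
  have "A = {c}"
  proof (cases "c \<in> A")
    case True
    then show ?thesis
      using same(1) by blast
  next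
    case False
    then consider "c \<in> B" | "c \<in> C"
      using C[of c] by argo
    then have "B = {c} \<or> C = {c}"
      by cases (use same(2,3) in blast)+
    \<comment> \<open>If \<open>{c}\<close> is one of the larger classes, the size ordering makes
      \<open>A\<close> a singleton, whose mean \<open>c\<close> is its element.\<close>
    then have "card A = 1"
      using card pos by auto
    then obtain d where d: "A = {d}"
      by (rule card_1_singletonE)
    then show ?thesis
      by (simp add: c_def)
  qed
  then show ?thesis
    using bc by auto
qed

section \<open>Invariance under the six affine maps\<close>

lemma trans_T_equation:
  fixes a :: "nat \<Rightarrow> 'p::prime_card mod_ring"
  assumes "a 1 \<noteq> 0" "a 2 \<noteq> 0" "a 3 \<noteq> 0"
  shows "trans_T a b s 1 x = y \<longleftrightarrow> a 1 * y + a 2 * s + a 3 * x = b"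
    "trans_T a b s 2 x = y \<longleftrightarrow> a 1 * y + a 2 * x + a 3 * s = b"
    "trans_T a b s 3 x = y \<longleftrightarrow> a 1 * x + a 2 * y + a 3 * s = b"
    "trans_T a b s 4 x = y \<longleftrightarrow> a 1 * s + a 2 * y + a 3 * x = b"
    "trans_T a b s 5 x = y \<longleftrightarrow> a 1 * x + a 2 * s + a 3 * y = b"
    "trans_T a b s 6 x = y \<longleftrightarrow> a 1 * s + a 2 * x + a 3 * y = b"
  using assms unfolding trans_T_def trans_d_def trans_t_def
  by (auto simp: field_simps)

lemma inj_trans_T:
  fixes a :: "nat \<Rightarrow> 'p::prime_card mod_ring"
  assumes "a 1 \<noteq> 0" "a 2 \<noteq> 0" "a 3 \<noteq> 0"
  shows "inj (trans_T a b s i)"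
proof (rule injI)
  fix x y
  assume "trans_T a b s i x = trans_T a b s i y"
  then have "trans_d a i * x = trans_d a i * y"
    by (simp add: trans_T_def)
  moreover have "trans_d a i \<noteq> 0"
    using assms by (simp add: trans_d_def)
  ultimately show "x = y"
    by simp
qed

lemma trans_T_solution:
  fixes a :: "nat \<Rightarrow> 'p::prime_card mod_ring"
  assumes nz: "a 1 \<noteq> 0" "a 2 \<noteq> 0" "a 3 \<noteq> 0" and i: "i \<in> {1..6}"
  shows "\<exists>u v w. a 1 * u + a 2 * v + a 3 * w = b \<and> {u, v, w} = {s, x, trans_T a b s i x}"
proof -
  note eqs = trans_T_equation[OF nz, of b s x, THEN iffD1, OF refl]
  have perm: "{y, s, x} = {s, x, y}" "{y, x, s} = {s, x, y}" "{x, y, s} = {s, x, y}"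
    "{s, y, x} = {s, x, y}" "{x, s, y} = {s, x, y}" for y :: "'p mod_ring"
    by auto
  from i consider "i = 1" | "i = 2" | "i = 3" | "i = 4" | "i = 5" | "i = 6"
    by fastforce
  then show ?thesis
  proof cases
    case 1
    show ?thesis
      unfolding 1 using eqs(1) perm(1) by blast
  next
    case 2
    show ?thesis
      unfolding 2 using eqs(2) perm(2) by blast
  next
    case 3
    show ?thesis
      unfolding 3 using eqs(3) perm(3) by blast
  next
    case 4
    show ?thesis
      unfolding 4 using eqs(4) perm(4) by blast
  next
    case 5
    show ?thesis
      unfolding 5 using eqs(5) perm(5) by blast
  next
    case 6
    show ?thesis
      unfolding 6 using eqs(6) by blast
  qed
qed

text \<open>Each map is injective and fixes \<open>s\<close>, and \<open>s\<close>, \<open>x\<close>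
  and the image of \<open>x\<close> solve the equation; rainbow-freeness therefore makes it preserve
  \<open>B\<close> and \<open>C\<close>, and finiteness gives equality. Conversely, a rainbow
  solution would yield a map taking an element of \<open>C\<close> into \<open>B\<close>.\<close>

lemma rainbow_free_iff_invariant:
  fixes a :: "nat \<Rightarrow> 'p::prime_card mod_ring"
  assumes nz: "a 1 \<noteq> 0" "a 2 \<noteq> 0" "a 3 \<noteq> 0"
    and part: "three_coloring {s} B C" and s: "s * (a 1 + a 2 + a 3) = b"
  shows "rainbow_free a b {s} B C \<longleftrightarrow>
    (\<forall>i\<in>{1..6}. trans_T a b s i ` B = B \<and> trans_T a b s i ` C = C)"
    (is "?free \<longleftrightarrow> ?inv")
proof -
  note eqs = trans_T_equation[OF nz]
  have parts: "insert s (B \<union> C) = UNIV" "s \<notin> B" "s \<notin> C" "B \<inter> C = {}"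
    using part unfolding three_coloring_def by auto
  show ?thesis
  proof
    assume free: ?free
    show ?inv
    proof
      fix i :: nat
      assume i: "i \<in> {1..6}"
      let ?T = "trans_T a b s i"
      have no: "\<not> rainbow {s} B C {s, x, ?T x}" for x
        using free trans_T_solution[OF nz i, of b s x] unfolding rainbow_free_iff by metis
      have inj: "inj ?T"
        by (rule inj_trans_T[OF nz])
      have fixed: "?T s = s"
      proof -
        have "a 1 * s + a 2 * s + a 3 * s = b"
          using s by (simp add: algebra_simps)
        moreover consider "i = 1" | "i = 2" | "i = 3" | "i = 4" | "i = 5" | "i = 6"
          using i by fastforce
        ultimately show ?thesis
          using eqs[of b s s s] by cases auto
      qed
      have ne: "?T x \<noteq> s" if "x \<noteq> s" for x
        using inj that fixed by (metis injD)
      have B: "?T x \<in> B" if "x \<in> B" for x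
      proof -
        have "?T x \<notin> C"
          using no[of x] that unfolding rainbow_def by blast
        then show ?thesis
          using ne[of x] parts that by blast
      qed
      have C: "?T x \<in> C" if "x \<in> C" for x
      proof -
        have "?T x \<notin> B"
          using no[of x] that unfolding rainbow_def insert_commute[of x "?T x"] by blast
        then show ?thesis
          using ne[of x] parts that by blast
      qed
      show "?T ` B = B \<and> ?T ` C = C"
        using B C inj_on_subset[OF inj subset_UNIV]
        by (intro conjI endo_inj_surj) auto
    qed
  next
    assume inv: ?inv
    show ?free
      unfolding rainbow_free_iff
    proof (intro allI impI notI)
      fix x y z
      assume eq: "a 1 * x + a 2 * y + a 3 * z = b" and "rainbow {s} B C {x, y, z}"
      then obtain v w where vw: "v \<in> B" "w \<in> C" "{x, y, z} = {s, v, w}"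
        unfolding rainbow_def by blast
      have no: "trans_T a b s i w \<noteq> v" if "i \<in> {1..6}" for i
        using inv that vw parts by blast
      have "s \<noteq> v" "s \<noteq> w" "v \<noteq> w"
        using vw parts by blast+
      \<comment> \<open>The six orders of \<open>s\<close>, \<open>v\<close>, \<open>w\<close> match
        the six maps: in each order exactly the corresponding equation says that \<open>w\<close> is
        sent to \<open>v\<close>.\<close>
      then have "(x, y, z) \<in> orderings s v w"
        using vw(3) unfolding orderings_def by (simp add: set_eq_iff) metis
      then consider "x = s" "y = v" "z = w" | "x = s" "y = w" "z = v" | "x = v" "y = s" "z = w"
        | "x = v" "y = w" "z = s" | "x = w" "y = s" "z = v" | "x = w" "y = v" "z = s"
        unfolding orderings_def by fastforce
      then show False
        using eq no[of 1] no[of 2] no[of 3] no[of 4] no[of 5] no[of 6] eqs[of b s w v]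
        by cases auto
    qed
  qed
qed

theorem theorem7:
  fixes a :: "nat \<Rightarrow> 'p::prime_card mod_ring"
    and b :: "'p mod_ring"
    and A B C :: "'p mod_ring set"
  assumes "a 1 * a 2 * a 3 \<noteq> 0"
    and "\<exists>i\<in>{1, 2, 3}. \<exists>j\<in>{1, 2, 3}. a i \<noteq> a j"
    and "three_coloring A B C"
    and "1 \<le> card A" and "card A \<le> card B" and "card B \<le> card C"
  shows "rainbow_free a b A B C \<longleftrightarrow>
    (\<exists>s. A = {s} \<and> s * (a 1 + a 2 + a 3) = b \<and>
      (\<forall>i\<in>{1..6}. trans_T a b s i ` B = B \<and> trans_T a b s i ` C = C))"
proof -
  have nz: "a 1 \<noteq> 0" "a 2 \<noteq> 0" "a 3 \<noteq> 0"
    using assms(1) by auto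
  have "\<not> (a 1 = a 2 \<and> a 2 = a 3)"
    using assms(2) by auto
  then have "\<exists>s. A = {s} \<and> s * (a 1 + a 2 + a 3) = b" if "rainbow_free a b A B C"
    using rainbow_free_singleton[OF assms(1) _ assms(3,5,6) that] by blast
  then show ?thesis
    using rainbow_free_iff_invariant[OF nz] assms(3) by metis
qed

end
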